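(* The following hold in $\mathbf{ZF}$. (a) The statement "every sequential subspace of $\mathbb{R}$ is Loeb" implies $\mathbf{CAC}_{\omega}(\mathbb{R})$. (b) The statement "every sequential metrizable space is Loeb" is equivalent to the axiom of choice $\mathbf{AC}$.
   Context: The base theory is $\mathbf{ZF}$. $\mathbb{R}$ carries its usual topology. A subset $A$ of a topological space $\mathbf{X}$ is sequentially closed in $\mathbf{X}$ if all limits of convergent in $\mathbf{X}$ sequences of points of $A$ belong to $A$. A topological space is sequential if every sequentially closed subset of it is closed. A topological space is Loeb if it is empty or the collection of all its non-empty closed subsets has a choice function. $\mathbf{CAC}_{\omega}(\mathbb{R})$: every infinite countable family of non-empty countable subsets of $\mathbb{R}$ has a choice function. *)

theory Defs
  imports "HOL-Algebra.Ring"
begin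

text \<open>
  HOL proves the axiom of choice, so a statement about what holds in ZF cannot be made about HOL
  types and sets. Here ZF is a first-order theory in the language of membership, and "holds in
  ZF" is read as "holds in every model of ZF". A model is a type with a binary relation
  \<^term>\<open>mem\<close>; it satisfies Separation and Replacement for first-order formulas with parameters
  only (for arbitrary HOL predicates these schemes would yield choice in the model).
  All notions below are interpreted inside the structure: quantifiers range over its elements,
  and functions, families, sequences, topologies and real numbers are elements of it.
\<close>

text \<open>Formulas use de Bruijn indices: \<^term>\<open>Forall\<close> binds index 0.\<close>

datatype fm = Member nat nat | Equal nat nat | Neg fm | Conj fm fm | Forall fm

locale set_structure =
  fixes mem :: "'a \<Rightarrow> 'a \<Rightarrow> bool"
begin

primrec sat :: "fm \<Rightarrow> (nat \<Rightarrow> 'a) \<Rightarrow> bool" where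
  "sat (Member i j) v \<longleftrightarrow> mem (v i) (v j)"
| "sat (Equal i j) v \<longleftrightarrow> v i = v j"
| "sat (Neg p) v \<longleftrightarrow> \<not> sat p v"
| "sat (Conj p q) v \<longleftrightarrow> sat p v \<and> sat q v"
| "sat (Forall p) v \<longleftrightarrow> (\<forall>x. sat p (case_nat x v))"

definition elts :: "'a \<Rightarrow> 'a set" where
  "elts a = {x. mem x a}"

end

locale zf_model = set_structure +
  assumes extensionality: "elts a = elts b \<Longrightarrow> a = b"
    and foundation: "elts a \<noteq> {} \<Longrightarrow> \<exists>x\<in>elts a. elts x \<inter> elts a = {}"
    and pairing: "\<exists>c. elts c = {a, b}"
    and union: "\<exists>u. elts u = (\<Union>x\<in>elts a. elts x)"
    and power_set: "\<exists>p. elts p = {x. elts x \<subseteq> elts a}"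
    and infinity: "\<exists>w. (\<exists>e\<in>elts w. elts e = {}) \<and>
                       (\<forall>x\<in>elts w. \<exists>s\<in>elts w. elts s = insert x (elts x))"
    and separation: "\<exists>b. elts b = {x \<in> elts a. sat p (case_nat x v)}"
    and replacement: "(\<forall>x\<in>elts a. \<exists>!y. sat q (case_nat x (case_nat y v))) \<Longrightarrow>
                      \<exists>b. elts b = {y. \<exists>x\<in>elts a. sat q (case_nat x (case_nat y v))}"

context set_structure
begin

subsection \<open>Relations, functions and natural numbers\<close>

text \<open>Kuratowski pairs.\<close>

definition is_pair :: "'a \<Rightarrow> 'a \<Rightarrow> 'a \<Rightarrow> bool" where
  "is_pair p x y \<longleftrightarrow> (\<exists>s d. elts s = {x} \<and> elts d = {x, y} \<and> elts p = {s, d})"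

definition rel :: "'a \<Rightarrow> 'a \<Rightarrow> 'a \<Rightarrow> bool" where
  "rel r x y \<longleftrightarrow> (\<exists>p\<in>elts r. is_pair p x y)"

definition is_product :: "'a \<Rightarrow> 'a \<Rightarrow> 'a \<Rightarrow> bool" where
  "is_product P A B \<longleftrightarrow> elts P = {p. \<exists>x\<in>elts A. \<exists>y\<in>elts B. is_pair p x y}"

definition is_function :: "'a \<Rightarrow> 'a \<Rightarrow> 'a \<Rightarrow> bool" where
  "is_function f A B \<longleftrightarrow>
     (\<forall>p\<in>elts f. \<exists>x\<in>elts A. \<exists>y\<in>elts B. is_pair p x y) \<and>
     (\<forall>x\<in>elts A. \<exists>!y. rel f x y)"

definition app :: "'a \<Rightarrow> 'a \<Rightarrow> 'a" where
  "app f x = (THE y. rel f x y)"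

definition is_function2 :: "'a \<Rightarrow> 'a \<Rightarrow> 'a \<Rightarrow> 'a \<Rightarrow> bool" where
  "is_function2 f A B C \<longleftrightarrow> (\<exists>P. is_product P A B \<and> is_function f P C)"

definition app2 :: "'a \<Rightarrow> 'a \<Rightarrow> 'a \<Rightarrow> 'a" where
  "app2 f x y = (THE z. \<exists>p. is_pair p x y \<and> rel f p z)"

definition is_bijection :: "'a \<Rightarrow> 'a \<Rightarrow> 'a \<Rightarrow> bool" where
  "is_bijection f A B \<longleftrightarrow> is_function f A B \<and> bij_betw (app f) (elts A) (elts B)"

definition is_inductive :: "'a \<Rightarrow> bool" where
  "is_inductive w \<longleftrightarrow> (\<exists>e\<in>elts w. elts e = {}) \<and>
                     (\<forall>x\<in>elts w. \<exists>s\<in>elts w. elts s = insert x (elts x))"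

definition omega :: 'a where
  "omega = (THE w. is_inductive w \<and> (\<forall>u. is_inductive u \<longrightarrow> elts w \<subseteq> elts u))"

text \<open>Countable means equipotent to a subset of \<^term>\<open>omega\<close>, so finite sets are countable.\<close>

definition is_finite :: "'a \<Rightarrow> bool" where
  "is_finite A \<longleftrightarrow> (\<exists>n\<in>elts omega. \<exists>f. is_bijection f A n)"

definition is_countable :: "'a \<Rightarrow> bool" where
  "is_countable A \<longleftrightarrow> (\<exists>B f. elts B \<subseteq> elts omega \<and> is_bijection f A B)"

subsection \<open>Choice\<close>

definition choice_function :: "'a \<Rightarrow> 'a \<Rightarrow> bool" where
  "choice_function c F \<longleftrightarrow> (\<exists>B. is_function c F B) \<and> (\<forall>A\<in>elts F. app c A \<in> elts A)"

definition AC :: bool where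
  "AC \<longleftrightarrow> (\<forall>F. (\<forall>A\<in>elts F. elts A \<noteq> {}) \<longrightarrow> (\<exists>c. choice_function c F))"

definition CAC_omega :: "'a \<Rightarrow> bool" where
  "CAC_omega R \<longleftrightarrow>
     (\<forall>F. \<not> is_finite F \<and> is_countable F \<and>
          (\<forall>A\<in>elts F. elts A \<subseteq> elts R \<and> elts A \<noteq> {} \<and> is_countable A) \<longrightarrow>
          (\<exists>c. choice_function c F))"

subsection \<open>Topological spaces\<close>

definition is_topology :: "'a \<Rightarrow> 'a \<Rightarrow> bool" where
  "is_topology X T \<longleftrightarrow>
     (\<forall>U\<in>elts T. elts U \<subseteq> elts X) \<and>
     (\<exists>e\<in>elts T. elts e = {}) \<and> X \<in> elts T \<and>
     (\<forall>U\<in>elts T. \<forall>V\<in>elts T. \<exists>W\<in>elts T. elts W = elts U \<inter> elts V) \<and>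
     (\<forall>S. elts S \<subseteq> elts T \<longrightarrow> (\<exists>W\<in>elts T. elts W = (\<Union>U\<in>elts S. elts U)))"

definition is_subspace :: "'a \<Rightarrow> 'a \<Rightarrow> 'a \<Rightarrow> 'a \<Rightarrow> bool" where
  "is_subspace Y S X T \<longleftrightarrow>
     elts Y \<subseteq> elts X \<and> elts S = {U. \<exists>V\<in>elts T. elts U = elts V \<inter> elts Y}"

definition closed_set :: "'a \<Rightarrow> 'a \<Rightarrow> 'a \<Rightarrow> bool" where
  "closed_set X T C \<longleftrightarrow> elts C \<subseteq> elts X \<and> (\<exists>U\<in>elts T. elts U = elts X - elts C)"

text \<open>On \<^term>\<open>omega\<close>, \<open>n \<le> m\<close> means \<open>n \<in> m\<close> or \<open>n = m\<close>.\<close>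

definition converges :: "'a \<Rightarrow> 'a \<Rightarrow> 'a \<Rightarrow> 'a \<Rightarrow> bool" where
  "converges X T s x \<longleftrightarrow> x \<in> elts X \<and>
     (\<forall>U\<in>elts T. x \<in> elts U \<longrightarrow>
        (\<exists>n\<in>elts omega. \<forall>m\<in>elts omega. n \<in> elts m \<or> n = m \<longrightarrow> app s m \<in> elts U))"

definition sequentially_closed :: "'a \<Rightarrow> 'a \<Rightarrow> 'a \<Rightarrow> bool" where
  "sequentially_closed X T A \<longleftrightarrow> elts A \<subseteq> elts X \<and>
     (\<forall>s x. is_function s omega A \<and> converges X T s x \<longrightarrow> x \<in> elts A)"

definition sequential :: "'a \<Rightarrow> 'a \<Rightarrow> bool" where
  "sequential X T \<longleftrightarrow> is_topology X T \<and>
     (\<forall>A. sequentially_closed X T A \<longrightarrow> closed_set X T A)"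

definition Loeb :: "'a \<Rightarrow> 'a \<Rightarrow> bool" where
  "Loeb X T \<longleftrightarrow> is_topology X T \<and>
     (elts X = {} \<or>
      (\<exists>F c. elts F = {C. closed_set X T C \<and> elts C \<noteq> {}} \<and> choice_function c F))"

subsection \<open>The real line and metric spaces\<close>

text \<open>
  The real numbers of the structure are a Dedekind-complete ordered field that is an element of
  it; such a field exists in every model of ZF and is unique up to isomorphism there.
  Completeness concerns only those subsets that are elements of the structure.
\<close>

definition le :: "'a \<Rightarrow> 'a \<Rightarrow> 'a \<Rightarrow> bool" where
  "le ltR x y \<longleftrightarrow> rel ltR x y \<or> x = y"

definition real_field :: "'a \<Rightarrow> 'a \<Rightarrow> 'a \<Rightarrow> 'a \<Rightarrow> 'a \<Rightarrow> 'a \<Rightarrow> bool" where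
  "real_field R addR mulR zeroR oneR ltR \<longleftrightarrow>
     is_function2 addR R R R \<and> is_function2 mulR R R R \<and>
     field \<lparr>carrier = elts R, mult = app2 mulR, one = oneR, zero = zeroR, add = app2 addR\<rparr> \<and>
     (\<forall>x\<in>elts R. \<not> rel ltR x x) \<and>
     (\<forall>x\<in>elts R. \<forall>y\<in>elts R. \<forall>z\<in>elts R. rel ltR x y \<and> rel ltR y z \<longrightarrow> rel ltR x z) \<and>
     (\<forall>x\<in>elts R. \<forall>y\<in>elts R. rel ltR x y \<or> x = y \<or> rel ltR y x) \<and>
     (\<forall>x\<in>elts R. \<forall>y\<in>elts R. \<forall>z\<in>elts R.
        rel ltR x y \<longrightarrow> rel ltR (app2 addR x z) (app2 addR y z)) \<and>
     (\<forall>x\<in>elts R. \<forall>y\<in>elts R.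
        rel ltR zeroR x \<and> rel ltR zeroR y \<longrightarrow> rel ltR zeroR (app2 mulR x y)) \<and>
     (\<forall>S. elts S \<subseteq> elts R \<and> elts S \<noteq> {} \<and> (\<exists>b\<in>elts R. \<forall>x\<in>elts S. le ltR x b) \<longrightarrow>
        (\<exists>l\<in>elts R. (\<forall>x\<in>elts S. le ltR x l) \<and>
           (\<forall>b\<in>elts R. (\<forall>x\<in>elts S. le ltR x b) \<longrightarrow> le ltR l b)))"

definition usual_topology :: "'a \<Rightarrow> 'a \<Rightarrow> 'a \<Rightarrow> bool" where
  "usual_topology R ltR T \<longleftrightarrow>
     elts T = {U. elts U \<subseteq> elts R \<and>
       (\<forall>x\<in>elts U. \<exists>a\<in>elts R. \<exists>b\<in>elts R. rel ltR a x \<and> rel ltR x b \<and>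
          (\<forall>y\<in>elts R. rel ltR a y \<and> rel ltR y b \<longrightarrow> y \<in> elts U))}"

definition is_metric :: "'a \<Rightarrow> 'a \<Rightarrow> 'a \<Rightarrow> 'a \<Rightarrow> 'a \<Rightarrow> 'a \<Rightarrow> bool" where
  "is_metric R addR zeroR ltR X d \<longleftrightarrow>
     is_function2 d X X R \<and>
     (\<forall>x\<in>elts X. \<forall>y\<in>elts X. le ltR zeroR (app2 d x y)) \<and>
     (\<forall>x\<in>elts X. \<forall>y\<in>elts X. app2 d x y = zeroR \<longleftrightarrow> x = y) \<and>
     (\<forall>x\<in>elts X. \<forall>y\<in>elts X. app2 d x y = app2 d y x) \<and>
     (\<forall>x\<in>elts X. \<forall>y\<in>elts X. \<forall>z\<in>elts X.
        le ltR (app2 d x z) (app2 addR (app2 d x y) (app2 d y z)))"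

definition metrizable :: "'a \<Rightarrow> 'a \<Rightarrow> 'a \<Rightarrow> 'a \<Rightarrow> 'a \<Rightarrow> 'a \<Rightarrow> bool" where
  "metrizable R addR zeroR ltR X T \<longleftrightarrow> is_topology X T \<and>
     (\<exists>d. is_metric R addR zeroR ltR X d \<and>
        elts T = {U. elts U \<subseteq> elts X \<and>
          (\<forall>x\<in>elts U. \<exists>e\<in>elts R. rel ltR zeroR e \<and>
             (\<forall>y\<in>elts X. rel ltR (app2 d x y) e \<longrightarrow> y \<in> elts U))})"

end

end

theory Submission
  imports Defs
begin

text \<open>
  Everything takes place inside a model of ZF, where a subset of a set is available only if it is
  cut out by a first-order formula with parameters, and where no choices may be made.

  Part (b). Discrete spaces are metrizable and sequential, and every subset of them is closed. If
  all sequential metrizable spaces are Loeb, then the discrete space on \<open>\<Union>F\<close> is Loeb, and its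
  choice function for nonempty closed sets, restricted to \<open>F\<close>, is a choice function for \<open>F\<close>
  (\<open>Loeb_imp_AC\<close>). Conversely the nonempty closed subsets of any space form a set, to which the
  axiom of choice applies (\<open>AC_imp_Loeb\<close>).

  Part (a). Let \<open>F\<close> be a countable family of nonempty countable sets of reals. Its members are
  copied injectively into pairwise disjoint open intervals of length \<open>width\<close>; let \<open>X\<close> be the union
  of the copies. Each copy is closed in \<open>X\<close>, so if the subspace \<open>X\<close> is Loeb, its choice function
  picks a point in every copy, and the copying maps carry these points back into the members of
  \<open>F\<close>. It remains to see that \<open>X\<close> is sequential. Let \<open>C\<close> be sequentially closed in \<open>X\<close>, and suppose
  that a point \<open>x\<close> of \<open>X\<close> outside \<open>C\<close> is in its closure. Near \<open>x\<close> only the copy containing \<open>x\<close>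
  matters, so \<open>x\<close> is a limit from the left or from the right of a countable set \<open>D\<close> contained in
  \<open>C\<close>. Fix an indexing of \<open>D\<close> by natural numbers and a point of \<open>D\<close>; the sequence whose \<open>m\<close>-th term
  is the point nearest to \<open>x\<close> among the fixed point and the points with index below \<open>m\<close> is defined
  without any choice and converges to \<open>x\<close> (\<open>ex_cofinal_sequence\<close>, \<open>no_one_sided_limit\<close>). An
  indexing is needed for one copy at a time only, so no choice of indexings for all members of
  \<open>F\<close> takes place.

  The copying maps need not be continuous, because only the countability of the copies is used.
  This permits a simple map: a member of \<open>F\<close> that meets the interval from \<open>-2\<close> to \<open>2\<close> is
  represented by its points there, and any other member by the inverses of its points.
\<close>

section \<open>Definable classes and Separation\<close>

primrec rename :: "(nat \<Rightarrow> nat) \<Rightarrow> fm \<Rightarrow> fm" where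
  "rename f (Member i j) = Member (f i) (f j)"
| "rename f (Equal i j) = Equal (f i) (f j)"
| "rename f (Neg p) = Neg (rename f p)"
| "rename f (Conj p q) = Conj (rename f p) (rename f q)"
| "rename f (Forall p) = Forall (rename (case_nat 0 (\<lambda>k. Suc (f k))) p)"

context set_structure
begin

text \<open>
  A predicate on assignments is definable if a formula with parameters expresses it. Parameters
  are written as constant functions of the assignment, so that definability of a concrete predicate
  follows by resolution along its logical structure, without handling de Bruijn indices.
\<close>

definition simple_term :: "((nat \<Rightarrow> 'a) \<Rightarrow> 'a) \<Rightarrow> bool" where
  "simple_term t \<longleftrightarrow> (\<exists>i. t = (\<lambda>v. v i)) \<or> (\<exists>c. t = (\<lambda>v. c))"

inductive definable :: "((nat \<Rightarrow> 'a) \<Rightarrow> bool) \<Rightarrow> bool" where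
  mem: "simple_term s \<Longrightarrow> simple_term t \<Longrightarrow> definable (\<lambda>v. mem (s v) (t v))"
| eq: "simple_term s \<Longrightarrow> simple_term t \<Longrightarrow> definable (\<lambda>v. s v = t v)"
| neg: "definable P \<Longrightarrow> definable (\<lambda>v. \<not> P v)"
| conj: "definable P \<Longrightarrow> definable Q \<Longrightarrow> definable (\<lambda>v. P v \<and> Q v)"
| all_case: "definable P \<Longrightarrow> definable (\<lambda>v. \<forall>x. P (case_nat x v))"

lemma sat_rename: "sat (rename f p) v \<longleftrightarrow> sat p (\<lambda>n. v (f n))"
proof (induction p arbitrary: f v)
  case (Forall p)
  have "(\<lambda>n. case_nat x v (case_nat 0 (\<lambda>k. Suc (f k)) n)) = case_nat x (\<lambda>n. v (f n))"
    for x and v :: "nat \<Rightarrow> 'a" by (auto split: nat.split)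
  then show ?case by (simp only: rename.simps sat.simps Forall.IH)
qed simp_all

text \<open>
  A formula receives a single assignment. Variables are placed at its even positions and parameters
  at its odd positions, which leaves infinitely many positions for both.
\<close>

definition interleave :: "(nat \<Rightarrow> 'a) \<Rightarrow> (nat \<Rightarrow> 'a) \<Rightarrow> nat \<Rightarrow> 'a" where
  "interleave v w n = (if even n then v (n div 2) else w (n div 2))"

lemma interleave_simps [simp]:
  "interleave v w (2 * k) = v k" "interleave v w (Suc (2 * k)) = w k"
  by (auto simp: interleave_def)

text \<open>The free slot \<open>k\<close> lets the two terms of an atomic formula use different parameters.\<close>

lemma simple_term_interleave:
  assumes "simple_term t"
  shows "\<exists>i c. \<forall>v w. w k = c \<longrightarrow> interleave v w i = t v"
proof -
  from assms consider i where "t = (\<lambda>v. v i)" | c where "t = (\<lambda>v. c)"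
    unfolding simple_term_def by blast
  then show ?thesis
  proof cases
    case 1
    then show ?thesis by (intro exI[of _ "2 * i"]) auto
  next
    case 2
    then show ?thesis by (intro exI[of _ "Suc (2 * k)"] exI[of _ c]) auto
  qed
qed

lemma definable_imp_sat:
  assumes "definable P"
  shows "\<exists>p w. \<forall>v. P v \<longleftrightarrow> sat p (interleave v w)"
  using assms
proof induction
  case (mem s t)
  from simple_term_interleave[OF mem(1), of 0] obtain i c
    where s: "\<And>v w. w 0 = c \<Longrightarrow> interleave v w i = s v" by blast
  from simple_term_interleave[OF mem(2), of 1] obtain j d
    where t: "\<And>v w. w 1 = d \<Longrightarrow> interleave v w j = t v" by blast
  show ?case
    by (rule exI[of _ "Member i j"], rule exI[of _ "case_nat c (\<lambda>_. d)"]) (simp add: s t)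
next
  case (eq s t)
  from simple_term_interleave[OF eq(1), of 0] obtain i c
    where s: "\<And>v w. w 0 = c \<Longrightarrow> interleave v w i = s v" by blast
  from simple_term_interleave[OF eq(2), of 1] obtain j d
    where t: "\<And>v w. w 1 = d \<Longrightarrow> interleave v w j = t v" by blast
  show ?case
    by (rule exI[of _ "Equal i j"], rule exI[of _ "case_nat c (\<lambda>_. d)"]) (simp add: s t)
next
  case (neg P)
  then obtain p w where p: "\<forall>v. P v \<longleftrightarrow> sat p (interleave v w)" by blast
  show ?case by (rule exI[of _ "Neg p"], rule exI[of _ w]) (simp only: p[rule_format] sat.simps simp_thms)
next
  case (conj P Q)
  then obtain p q w1 w2 where p: "\<forall>v. P v \<longleftrightarrow> sat p (interleave v w1)"
    and q: "\<forall>v. Q v \<longleftrightarrow> sat q (interleave v w2)" by blast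
  \<comment> \<open>The two parameter sequences are themselves interleaved, and the formulas renamed to match.\<close>
  define f where "f k n = (if even n then n else Suc (2 * (2 * (n div 2) + k)))" for k n :: nat
  have f0: "(\<lambda>n. interleave v (interleave w1 w2) (f 0 n)) = interleave v w1"
    and f1: "(\<lambda>n. interleave v (interleave w1 w2) (f 1 n)) = interleave v w2" for v
    by (auto simp: fun_eq_iff f_def interleave_def elim!: oddE)
  show ?case
    by (rule exI[of _ "Conj (rename (f 0) p) (rename (f 1) q)"],
        rule exI[of _ "interleave w1 w2"])
      (simp only: sat.simps sat_rename f0 f1 p[rule_format] q[rule_format] simp_thms)
next
  case (all_case P)
  then obtain p w where p: "\<forall>v. P v \<longleftrightarrow> sat p (interleave v w)" by blast
  \<comment> \<open>Binding moves the new variable to position 0 of the whole assignment, but to position 0 of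
    the variables alone in the premise; the renaming mediates between the two layouts.\<close>
  define f where "f n = (if n = 0 then 0 else if even n then n - 1 else Suc n)" for n :: nat
  have f: "(\<lambda>n. case_nat x (interleave v w) (f n)) = interleave (case_nat x v) w" for x v
  proof
    fix n
    show "case_nat x (interleave v w) (f n) = interleave (case_nat x v) w n"
    proof (cases "even n")
      case True
      then obtain k where "n = 2 * k" by blast
      then show ?thesis by (cases k) (auto simp: f_def interleave_def)
    next
      case False
      then obtain k where "n = 2 * k + 1" by (auto elim: oddE)
      then show ?thesis by (auto simp: f_def)
    qed
  qed
  show ?case
    by (rule exI[of _ "Forall (rename f p)"], rule exI[of _ w])
      (simp only: sat.simps sat_rename f p[rule_format] simp_thms)
qed

lemma simple_term_subst:
  assumes "simple_term s" "\<And>n. simple_term (t n)"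
  shows "simple_term (\<lambda>v. s (\<lambda>n. t n v))"
  using assms unfolding simple_term_def by auto

text \<open>
  Under quantifiers a definable predicate that is given as a locally fixed variable has to be
  applied to shifted variables or to parameters; closure under substitution makes this possible.
\<close>

lemma definable_subst:
  assumes "definable P" "\<And>n. simple_term (t n)"
  shows "definable (\<lambda>v. P (\<lambda>n. t n v))"
  using assms
proof (induction arbitrary: t)
  case (mem r s)
  show ?case by (rule definable.mem; rule simple_term_subst; fact)
next
  case (eq r s)
  show ?case by (rule definable.eq; rule simple_term_subst; fact)
next
  case (neg P)
  show ?case by (rule definable.neg[OF neg.IH[OF neg.prems]])
next
  case (conj P Q)
  show ?case by (rule definable.conj[OF conj.IH(1)[OF conj.prems] conj.IH(2)[OF conj.prems]])
next
  case (all_case P)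
  define u where "u = case_nat (\<lambda>v. v 0) (\<lambda>k v. t k (\<lambda>n. v (Suc n)))"
  have u: "simple_term (u n)" for n
    using all_case.prems[of "n - 1"] by (cases n) (auto simp: u_def simple_term_def)
  have *: "(\<lambda>n. u n (case_nat x v)) = case_nat x (\<lambda>n. t n v)" for x v
    by (auto simp: u_def split: nat.split)
  have "definable (\<lambda>v. P (\<lambda>n. u n v))" by (rule all_case.IH[OF u])
  from definable.all_case[OF this] show ?case unfolding * .
qed

lemma simple_term_var: "simple_term (\<lambda>v. v i)"
  and simple_term_param: "simple_term (\<lambda>v. c)"
  unfolding simple_term_def by blast+

lemma simple_term_shift: "simple_term t \<Longrightarrow> simple_term (\<lambda>v. t (\<lambda>n. v (Suc n)))"
  unfolding simple_term_def by auto

text \<open>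
  Since the bound variable and the assignment are separate arguments of \<open>P\<close>, the conclusion is a
  higher-order pattern, and resolution with this rule descends below a quantifier automatically.
\<close>

lemma definable_all:
  assumes "definable (\<lambda>v. P (v 0) (\<lambda>n. v (Suc n)))"
  shows "definable (\<lambda>v. \<forall>x. P x v)"
  using all_case[OF assms] by simp

lemma definable_not: "definable P \<Longrightarrow> definable (\<lambda>v. \<not> P v)"
  by (rule neg)

lemma definable_and: "definable P \<Longrightarrow> definable Q \<Longrightarrow> definable (\<lambda>v. P v \<and> Q v)"
  by (rule conj)

lemma definable_or: "definable P \<Longrightarrow> definable Q \<Longrightarrow> definable (\<lambda>v. P v \<or> Q v)"
  using neg[OF conj[OF neg neg], of P Q] by simp

lemma definable_imp: "definable P \<Longrightarrow> definable Q \<Longrightarrow> definable (\<lambda>v. P v \<longrightarrow> Q v)"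
  using neg[OF conj[OF _ neg], of P Q] by simp

lemma definable_iff: "definable P \<Longrightarrow> definable Q \<Longrightarrow> definable (\<lambda>v. P v \<longleftrightarrow> Q v)"
  using conj[OF definable_imp definable_imp, of P Q Q P] by (simp add: iff_conv_conj_imp)

lemma definable_ex:
  assumes "definable (\<lambda>v. P (v 0) (\<lambda>n. v (Suc n)))"
  shows "definable (\<lambda>v. \<exists>x. P x v)"
  using neg[OF definable_all[OF neg[OF assms]]] by simp

lemma definable_in:
  "simple_term s \<Longrightarrow> simple_term t \<Longrightarrow> definable (\<lambda>v. s v \<in> elts (t v))"
  unfolding elts_def using mem by simp

lemma definable_eq: "simple_term s \<Longrightarrow> simple_term t \<Longrightarrow> definable (\<lambda>v. s v = t v)"
  by (rule eq)

lemma definable_ball: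
  assumes "simple_term t" and "definable (\<lambda>v. P (v 0) (\<lambda>n. v (Suc n)))"
  shows "definable (\<lambda>v. \<forall>x\<in>elts (t v). P x v)"
  unfolding Ball_def
  by (rule definable_all, rule definable_imp)
    (intro definable_in simple_term_var simple_term_shift assms)+

lemma definable_bex:
  assumes "simple_term t" and "definable (\<lambda>v. P (v 0) (\<lambda>n. v (Suc n)))"
  shows "definable (\<lambda>v. \<exists>x\<in>elts (t v). P x v)"
  unfolding Bex_def
  by (rule definable_ex, rule definable_and)
    (intro definable_in simple_term_var simple_term_shift assms)+

lemma definable_subst2:
  assumes "definable (\<lambda>v. G (v 0) (v 1))" "simple_term a" "simple_term b"
  shows "definable (\<lambda>v. G (a v) (b v))"
  using definable_subst[OF assms(1), of "case_nat a (\<lambda>_. b)"] assms(2,3)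
  by (auto split: nat.split)

lemma definable_subst3:
  assumes "definable (\<lambda>v. G (v 0) (v 1) (v 2))" "simple_term a" "simple_term b" "simple_term c"
  shows "definable (\<lambda>v. G (a v) (b v) (c v))"
  using definable_subst[OF assms(1), of "case_nat a (case_nat b (\<lambda>_. c))"] assms(2-4)
  by (auto simp: numeral_2_eq_2 split: nat.split)

lemma definable_False: "definable (\<lambda>v. False)"
  using conj[OF eq neg[OF eq], of "\<lambda>v. v 0" "\<lambda>v. v 0" "\<lambda>v. v 0" "\<lambda>v. v 0"]
  by (simp add: simple_term_var)

lemmas definable_logic =
  definable_False definable_not definable_and definable_or definable_imp definable_iff
  definable_ball definable_bex definable_all definable_ex
  definable_in definable_eq simple_term_var simple_term_param

lemma definable_subset:
  assumes "simple_term s" "simple_term t"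
  shows "definable (\<lambda>v. elts (s v) \<subseteq> elts (t v))"
  unfolding subset_iff
  by (intro definable_logic simple_term_shift assms)

lemma definable_empty:
  assumes "simple_term s"
  shows "definable (\<lambda>v. elts (s v) = {})"
  unfolding set_eq_iff empty_iff
  by (intro definable_logic simple_term_shift assms)

lemma definable_successor:
  assumes "simple_term s" "simple_term t"
  shows "definable (\<lambda>v. elts (t v) = insert (s v) (elts (s v)))"
  unfolding set_eq_iff insert_iff
  by (intro definable_logic simple_term_shift assms)

lemma definable_is_pair:
  assumes "simple_term p" "simple_term x" "simple_term y"
  shows "definable (\<lambda>v. is_pair (p v) (x v) (y v))"
  unfolding is_pair_def set_eq_iff insert_iff empty_iff
  by (intro definable_logic simple_term_shift assms)

lemma definable_rel:
  assumes "simple_term r" "simple_term x" "simple_term y"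
  shows "definable (\<lambda>v. rel (r v) (x v) (y v))"
  unfolding rel_def
  by (intro definable_logic definable_is_pair simple_term_shift assms)

text \<open>
  The description operator in \<^const>\<open>app2\<close> is not definable outside the domain of the function,
  so formulas speak about the graph of a binary operation instead.
\<close>

definition rel2 :: "'a \<Rightarrow> 'a \<Rightarrow> 'a \<Rightarrow> 'a \<Rightarrow> bool" where
  "rel2 f x y z \<longleftrightarrow> (\<exists>p. is_pair p x y \<and> rel f p z)"

lemma definable_rel2:
  assumes "simple_term f" "simple_term x" "simple_term y" "simple_term z"
  shows "definable (\<lambda>v. rel2 (f v) (x v) (y v) (z v))"
  unfolding rel2_def
  by (intro definable_logic definable_is_pair definable_rel simple_term_shift assms)

lemmas definable_intros =
  definable_subset definable_empty definable_successor definable_is_pair definable_rel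
  definable_rel2 definable_logic

lemma definable_is_inductive:
  assumes "simple_term w"
  shows "definable (\<lambda>v. is_inductive (w v))"
  unfolding is_inductive_def
  by (intro definable_intros simple_term_shift assms)

end

context zf_model
begin

text \<open>The separated element is the only variable; all even positions may therefore carry it.\<close>

lemma separation_definable:
  assumes "definable (\<lambda>v. P (v 0))"
  obtains b where "elts b = {x \<in> elts a. P x}"
proof -
  obtain p w where p: "\<forall>v. P (v 0) \<longleftrightarrow> sat p (interleave v w)"
    using definable_imp_sat[OF assms] by blast
  define f where "f n = (if even n then 0 else Suc (n div 2))" for n :: nat
  have "(\<lambda>n. case_nat x w (f n)) = interleave (\<lambda>_. x) w" for x
    by (auto simp: fun_eq_iff f_def interleave_def)
  then have "sat (rename f p) (case_nat x w) \<longleftrightarrow> P x" for x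
    using p[rule_format, of "\<lambda>_. x"] by (simp only: sat_rename)
  then show ?thesis using separation[of a "rename f p" w] that by auto
qed

section \<open>Pairs, functions and natural numbers\<close>

lemma ex_pair: "\<exists>p. is_pair p x y"
  unfolding is_pair_def by (metis pairing insert_absorb2)

lemma is_pair_unique: "is_pair p x y \<Longrightarrow> is_pair q x y \<Longrightarrow> p = q"
  unfolding is_pair_def using extensionality by metis

lemma is_pair_inject:
  assumes "is_pair p x y" "is_pair p x' y'"
  shows "x = x' \<and> y = y'"
proof -
  obtain s d s' d' where *: "elts s = {x}" "elts d = {x, y}" "elts p = {s, d}"
    "elts s' = {x'}" "elts d' = {x', y'}" "elts p = {s', d'}"
    using assms unfolding is_pair_def by blast
  then show ?thesis by (metis doubleton_eq_iff insert_absorb2 singleton_insert_inj_eq')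
qed

lemma is_pair_diagonal: "is_pair p x y \<Longrightarrow> (\<exists>z. is_pair p z z) \<longleftrightarrow> x = y"
  using is_pair_inject by blast

lemma rel_iff_mem: "is_pair p x y \<Longrightarrow> rel r x y \<longleftrightarrow> p \<in> elts r"
  unfolding rel_def using is_pair_unique by blast

lemma ex_product: "\<exists>P. is_product P A B"
proof -
  obtain ab where ab: "elts ab = {A, B}" using pairing by blast
  obtain u where u: "elts u = elts A \<union> elts B" using union[of ab] ab by auto
  obtain pu where pu: "elts pu = {x. elts x \<subseteq> elts u}" using power_set by blast
  obtain ppu where ppu: "elts ppu = {x. elts x \<subseteq> elts pu}" using power_set by blast
  have "definable (\<lambda>v. \<exists>x\<in>elts A. \<exists>y\<in>elts B. is_pair (v 0) x y)"
    by (intro definable_intros)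
  then obtain P where "elts P = {p \<in> elts ppu. \<exists>x\<in>elts A. \<exists>y\<in>elts B. is_pair p x y}"
    by (rule separation_definable)
  moreover have "p \<in> elts ppu" if "x \<in> elts A" "y \<in> elts B" "is_pair p x y" for p x y
    using that unfolding is_pair_def ppu pu u by (auto simp: ppu pu u)
  ultimately show ?thesis unfolding is_product_def by blast
qed

lemma rel_product: "is_product P A B \<Longrightarrow> is_pair p x y \<Longrightarrow> p \<in> elts P \<longleftrightarrow> x \<in> elts A \<and> y \<in> elts B"
  unfolding is_product_def using is_pair_inject by blast

lemma function_rel: "is_function f A B \<Longrightarrow> rel f x y \<Longrightarrow> x \<in> elts A \<and> y \<in> elts B"
  unfolding is_function_def rel_def using is_pair_inject by metis

lemma function_rel_iff:
  assumes "is_function f A B" "x \<in> elts A"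
  shows "rel f x y \<longleftrightarrow> y = app f x"
proof -
  have "\<exists>!y. rel f x y" using assms unfolding is_function_def by blast
  then show ?thesis unfolding app_def by (metis theI_unique)
qed

lemma function_app: "is_function f A B \<Longrightarrow> x \<in> elts A \<Longrightarrow> app f x \<in> elts B"
  using function_rel_iff function_rel by blast

lemma function2_rel2_iff:
  assumes "is_function2 f A B C" "x \<in> elts A" "y \<in> elts B"
  shows "rel2 f x y z \<longleftrightarrow> z = app2 f x y" and "app2 f x y \<in> elts C"
proof -
  obtain P where P: "is_product P A B" "is_function f P C"
    using assms(1) unfolding is_function2_def by blast
  obtain p where p: "is_pair p x y" using ex_pair by blast
  have pP: "p \<in> elts P" using rel_product[OF P(1) p] assms by blast
  have *: "rel2 f x y z \<longleftrightarrow> z = app f p" for z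
    unfolding rel2_def using function_rel_iff[OF P(2) pP] p is_pair_unique by blast
  then have "app2 f x y = app f p"
    unfolding app2_def rel2_def[symmetric] by simp
  then show "rel2 f x y z \<longleftrightarrow> z = app2 f x y" "app2 f x y \<in> elts C"
    using * function_app[OF P(2) pP] by auto
qed

lemma ex_relation:
  assumes G: "definable (\<lambda>v. G (v 0) (v 1))"
  obtains r where "\<And>x y. rel r x y \<longleftrightarrow> x \<in> elts A \<and> y \<in> elts B \<and> G x y"
    and "\<And>p. p \<in> elts r \<Longrightarrow> \<exists>x\<in>elts A. \<exists>y\<in>elts B. is_pair p x y"
proof -
  obtain P where P: "is_product P A B" using ex_product by blast
  have "definable (\<lambda>v. \<exists>x y. is_pair (v 0) x y \<and> G x y)"
    by (intro definable_intros definable_subst2[of G, OF G])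
  then obtain r where r: "elts r = {p \<in> elts P. \<exists>x y. is_pair p x y \<and> G x y}"
    by (rule separation_definable)
  show ?thesis
  proof (rule that)
    show "rel r x y \<longleftrightarrow> x \<in> elts A \<and> y \<in> elts B \<and> G x y" for x y
    proof -
      obtain p where p: "is_pair p x y" using ex_pair by blast
      show ?thesis
        unfolding rel_iff_mem[OF p] r using p is_pair_inject[OF p] rel_product[OF P p] by blast
    qed
    show "\<exists>x\<in>elts A. \<exists>y\<in>elts B. is_pair p x y" if "p \<in> elts r" for p
      using that P unfolding r is_product_def by blast
  qed
qed

text \<open>Functional relations become functions because the codomain is a given set: Separation on
  the product suffices.\<close>

lemma ex_function:
  assumes G: "definable (\<lambda>v. G (v 0) (v 1))"
    and total: "\<And>x. x \<in> elts A \<Longrightarrow> \<exists>!y. y \<in> elts B \<and> G x y"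
  obtains f where "is_function f A B" and "\<And>x. x \<in> elts A \<Longrightarrow> app f x \<in> elts B \<and> G x (app f x)"
proof -
  obtain f where f: "\<And>x y. rel f x y \<longleftrightarrow> x \<in> elts A \<and> y \<in> elts B \<and> G x y"
    "\<And>p. p \<in> elts f \<Longrightarrow> \<exists>x\<in>elts A. \<exists>y\<in>elts B. is_pair p x y"
    using ex_relation[OF G, of A B] by blast
  have fn: "is_function f A B"
    unfolding is_function_def
  proof (intro conjI ballI)
    show "\<exists>!y. rel f x y" if "x \<in> elts A" for x
      unfolding f(1) using total[OF that] that by simp
  qed (rule f(2))
  moreover have "app f x \<in> elts B \<and> G x (app f x)" if "x \<in> elts A" for x
    using f(1) function_rel_iff[OF fn that] by blast
  ultimately show ?thesis by (rule that)
qed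

lemma ex_choice_function:
  assumes G: "definable (\<lambda>v. G (v 0) (v 1))"
    and total: "\<And>A. A \<in> elts F \<Longrightarrow> \<exists>!x. x \<in> elts A \<and> G A x"
  shows "\<exists>c. choice_function c F"
proof -
  obtain B where B: "elts B = (\<Union>A\<in>elts F. elts A)" using union by blast
  have "definable (\<lambda>v. v 1 \<in> elts (v 0) \<and> G (v 0) (v 1))"
    by (intro definable_intros definable_subst2[of G, OF G])
  moreover have "\<exists>!y. y \<in> elts B \<and> y \<in> elts A \<and> G A y" if "A \<in> elts F" for A
    using total[OF that] that B by blast
  ultimately obtain c where "is_function c F B"
    "\<And>A. A \<in> elts F \<Longrightarrow> app c A \<in> elts B \<and> app c A \<in> elts A \<and> G A (app c A)"
    using ex_function[of "\<lambda>A x. x \<in> elts A \<and> G A x" F B] by blast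
  then show ?thesis unfolding choice_function_def by blast
qed

lemma choice_function_empty:
  assumes "elts F = {}"
  shows "\<exists>c. choice_function c F"
proof (rule ex_choice_function)
  show "definable (\<lambda>v. v 0 = v 1)" by (intro definable_intros)
qed (simp add: assms)

lemma choice_function_restrict:
  assumes "choice_function c F'" "elts F \<subseteq> elts F'"
  shows "\<exists>c. choice_function c F"
proof -
  obtain B where c: "is_function c F' B" "\<forall>A\<in>elts F'. app c A \<in> elts A"
    using assms(1) unfolding choice_function_def by blast
  show ?thesis
  proof (rule ex_choice_function)
    show "definable (\<lambda>v. rel c (v 0) (v 1))" by (intro definable_intros)
    show "\<exists>!x. x \<in> elts A \<and> rel c A x" if "A \<in> elts F" for A
      using that assms(2) c(2) function_rel_iff[OF c(1), of A] by auto
  qed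
qed

text \<open>Some inductive set exists; the intersection of all of them is separated from it.\<close>

lemma inductive_omega: "is_inductive omega"
  and omega_least: "is_inductive u \<Longrightarrow> elts omega \<subseteq> elts u"
proof -
  obtain w0 where w0: "is_inductive w0" using infinity unfolding is_inductive_def by blast
  have "definable (\<lambda>v. \<forall>u. is_inductive u \<longrightarrow> v 0 \<in> elts u)"
    by (intro definable_intros definable_is_inductive)
  then obtain w where w: "elts w = {x \<in> elts w0. \<forall>u. is_inductive u \<longrightarrow> x \<in> elts u}"
    by (rule separation_definable)
  have "is_inductive w"
    unfolding is_inductive_def
  proof
    obtain e where e: "e \<in> elts w0" "elts e = {}" using w0 unfolding is_inductive_def by blast
    have "e \<in> elts u" if "is_inductive u" for u
    proof -
      obtain e' where "e' \<in> elts u" "elts e' = {}" using \<open>is_inductive u\<close> unfolding is_inductive_def by blast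
      then show ?thesis using extensionality[of e e'] e by simp
    qed
    then have "e \<in> elts w" unfolding w using e by blast
    then show "\<exists>e\<in>elts w. elts e = {}" using e by blast
    show "\<forall>x\<in>elts w. \<exists>s\<in>elts w. elts s = insert x (elts x)"
    proof
      fix x assume x: "x \<in> elts w"
      then obtain s where s: "s \<in> elts w0" "elts s = insert x (elts x)"
        using w w0 unfolding is_inductive_def by blast
      have "s \<in> elts u" if u: "is_inductive u" for u
      proof -
        have "x \<in> elts u" using x u w by blast
        then obtain s' where "s' \<in> elts u" "elts s' = insert x (elts x)"
          using u unfolding is_inductive_def by blast
        then show ?thesis using extensionality[of s s'] s by simp
      qed
      then show "\<exists>s\<in>elts w. elts s = insert x (elts x)" using s w by blast
    qed
  qed
  moreover have "elts w \<subseteq> elts u" if "is_inductive u" for u using w that by blast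
  ultimately have *: "is_inductive w \<and> (\<forall>u. is_inductive u \<longrightarrow> elts w \<subseteq> elts u)" by blast
  have "omega = w" unfolding omega_def
  proof (rule the_equality)
    show "is_inductive w \<and> (\<forall>u. is_inductive u \<longrightarrow> elts w \<subseteq> elts u)" by (rule *)
    show "w' = w" if "is_inductive w' \<and> (\<forall>u. is_inductive u \<longrightarrow> elts w' \<subseteq> elts u)" for w'
      using * that by (intro extensionality subset_antisym) blast+
  qed
  then have "is_inductive omega \<and> (\<forall>u. is_inductive u \<longrightarrow> elts omega \<subseteq> elts u)"
    using * by (rule ssubst)
  then show "is_inductive omega" "is_inductive u \<Longrightarrow> elts omega \<subseteq> elts u"
    by blast+
qed

definition omega_zero :: 'a where "omega_zero = (THE e. elts e = {})"

definition succ :: "'a \<Rightarrow> 'a" where "succ n = (THE s. elts s = insert n (elts n))"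

lemma the_elts: "elts a = S \<Longrightarrow> (THE b. elts b = S) = a"
  by (rule the_equality) (simp_all add: extensionality)

lemma zero_omega: "omega_zero \<in> elts omega" and elts_zero [simp]: "elts omega_zero = {}"
proof -
  obtain e where e: "e \<in> elts omega" "elts e = {}"
    using inductive_omega unfolding is_inductive_def by blast
  then have "omega_zero = e" unfolding omega_zero_def by (intro the_elts)
  with e show "omega_zero \<in> elts omega" "elts omega_zero = {}" by simp_all
qed

lemma succ_omega: "n \<in> elts omega \<Longrightarrow> succ n \<in> elts omega"
  and elts_succ: "n \<in> elts omega \<Longrightarrow> elts (succ n) = insert n (elts n)"
proof -
  assume "n \<in> elts omega"
  then obtain s where s: "s \<in> elts omega" "elts s = insert n (elts n)"
    using inductive_omega unfolding is_inductive_def by blast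
  then have "succ n = s" unfolding succ_def by (intro the_elts)
  with s show "succ n \<in> elts omega" "elts (succ n) = insert n (elts n)" by simp_all
qed

lemma succ_eq_iff: "n \<in> elts omega \<Longrightarrow> s = succ n \<longleftrightarrow> elts s = insert n (elts n)"
  using elts_succ extensionality by metis

lemma omega_induct [consumes 2, case_names zero succ]:
  assumes "definable (\<lambda>v. P (v 0))" and n: "n \<in> elts omega"
    and "P omega_zero" and step: "\<And>n. n \<in> elts omega \<Longrightarrow> P n \<Longrightarrow> P (succ n)"
  shows "P n"
proof -
  obtain w where w: "elts w = {n \<in> elts omega. P n}"
    using separation_definable[OF assms(1)] by blast
  have "is_inductive w" unfolding is_inductive_def
  proof
    show "\<exists>e\<in>elts w. elts e = {}"
      by (rule bexI[of _ omega_zero]) (simp_all add: w zero_omega assms(3))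
    show "\<forall>x\<in>elts w. \<exists>s\<in>elts w. elts s = insert x (elts x)"
    proof
      fix x assume "x \<in> elts w"
      then show "\<exists>s\<in>elts w. elts s = insert x (elts x)"
        by (intro bexI[of _ "succ x"]) (simp_all add: w elts_succ succ_omega step)
    qed
  qed
  then show ?thesis using omega_least n w by blast
qed

lemma omega_transitive:
  assumes "n \<in> elts omega" "k \<in> elts n"
  shows "elts k \<subseteq> elts n" "k \<in> elts omega"
proof -
  have "definable (\<lambda>v. \<forall>k\<in>elts (v 0). elts k \<subseteq> elts (v 0) \<and> k \<in> elts omega)"
    by (intro definable_intros)
  from this assms(1) have "\<forall>k\<in>elts n. elts k \<subseteq> elts n \<and> k \<in> elts omega"
    by (induction rule: omega_induct) (auto simp: elts_succ)
  then show "elts k \<subseteq> elts n" "k \<in> elts omega" using assms by auto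
qed

lemma omega_linear:
  assumes "m \<in> elts omega" "n \<in> elts omega"
  shows "m \<in> elts n \<or> m = n \<or> n \<in> elts m"
proof -
  have "definable (\<lambda>v. \<forall>n\<in>elts omega. v 0 \<in> elts n \<or> v 0 = n \<or> n \<in> elts (v 0))"
    by (intro definable_intros)
  from this assms(1) have "\<forall>n\<in>elts omega. m \<in> elts n \<or> m = n \<or> n \<in> elts m"
  proof (induction rule: omega_induct)
    case zero
    have "definable (\<lambda>v. omega_zero \<in> elts (v 0) \<or> omega_zero = v 0)" by (intro definable_intros)
    from this have "omega_zero \<in> elts n \<or> omega_zero = n" if "n \<in> elts omega" for n
      using that by (induction rule: omega_induct) (auto simp: elts_succ)
    then show ?case by blast
  next
    case (succ m)
    show ?case
    proof
      fix n assume n: "n \<in> elts omega"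
      have "definable (\<lambda>v. m \<in> elts (v 0) \<longrightarrow> succ m \<in> elts (v 0) \<or> succ m = v 0)"
        by (intro definable_intros)
      from this n have "m \<in> elts n \<longrightarrow> succ m \<in> elts n \<or> succ m = n"
        by (induction rule: omega_induct) (auto simp: elts_succ)
      then show "succ m \<in> elts n \<or> succ m = n \<or> n \<in> elts (succ m)"
        using succ n elts_succ by auto
    qed
  qed
  then show ?thesis using assms by blast
qed

lemma succ_inject:
  assumes "m \<in> elts omega" "n \<in> elts omega" "succ m = succ n"
  shows "m = n"
proof (rule ccontr)
  assume "m \<noteq> n"
  moreover have "insert m (elts m) = insert n (elts n)" using assms elts_succ by metis
  ultimately have mn: "m \<in> elts n" "n \<in> elts m" by auto
  obtain a where "elts a = {m, n}" using pairing by blast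
  then show False using foundation[of a] mn by auto
qed

text \<open>
  The graph of the recursively defined sequence is the least subset of the product of
  \<^const>\<open>omega\<close> and \<open>B\<close> that contains the initial pair and is closed under the step. Quantifying
  over all such subsets is first-order inside the model.
\<close>

lemma omega_recursion:
  assumes G: "definable (\<lambda>v. G (v 0) (v 1))"
    and b: "b \<in> elts B"
    and step: "\<And>x. x \<in> elts B \<Longrightarrow> \<exists>!y. y \<in> elts B \<and> G x y"
  obtains s where "is_function s omega B" and "app s omega_zero = b"
    and "\<And>n. n \<in> elts omega \<Longrightarrow> G (app s n) (app s (succ n))"
proof -
  define closed_under_step where "closed_under_step S \<longleftrightarrow> rel S omega_zero b \<and>
    (\<forall>n\<in>elts omega. \<forall>x\<in>elts B. rel S n x \<longrightarrow>
      (\<forall>m\<in>elts omega. \<forall>y\<in>elts B. elts m = insert n (elts n) \<and> G x y \<longrightarrow> rel S m y))" for S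
  have dc: "definable (\<lambda>v. \<forall>S. closed_under_step S \<longrightarrow> rel S (v 0) (v 1))"
    unfolding closed_under_step_def
    by (intro definable_intros definable_subst2[of G, OF G])
  obtain s where s: "\<And>n x. rel s n x \<longleftrightarrow>
      n \<in> elts omega \<and> x \<in> elts B \<and> (\<forall>S. closed_under_step S \<longrightarrow> rel S n x)"
    and s_pairs: "\<And>p. p \<in> elts s \<Longrightarrow> \<exists>n\<in>elts omega. \<exists>x\<in>elts B. is_pair p n x"
    using ex_relation[of "\<lambda>n x. \<forall>S. closed_under_step S \<longrightarrow> rel S n x" omega B, OF dc] by blast
  have s0: "rel s omega_zero b"
    using s zero_omega b closed_under_step_def by blast
  have s_step: "rel s (succ n) y" if "rel s n x" "y \<in> elts B" "G x y" for n x y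
  proof -
    have n: "n \<in> elts omega" and x: "x \<in> elts B" using s that by blast+
    have "rel S (succ n) y" if S: "closed_under_step S" for S
    proof -
      have "rel S n x" using S s \<open>rel s n x\<close> by blast
      then show ?thesis
        using S n x that \<open>y \<in> elts B\<close> \<open>G x y\<close> succ_omega[OF n] elts_succ[OF n]
        unfolding closed_under_step_def by blast
    qed
    then show ?thesis using s that succ_omega[OF n] by blast
  qed
  \<comment> \<open>A pair that is not produced by the two clauses could be removed from the least closed set.\<close>
  have s_inv: "(n = omega_zero \<and> x = b) \<or>
      (\<exists>k y. rel s k y \<and> n = succ k \<and> x \<in> elts B \<and> G y x)" if nx: "rel s n x" for n x
  proof -
    define Q where "Q n x \<longleftrightarrow> (n = omega_zero \<and> x = b) \<or>
      (\<exists>k\<in>elts omega. \<exists>y. rel s k y \<and> elts n = insert k (elts k) \<and> x \<in> elts B \<and> G y x)" for n x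
    have "definable (\<lambda>v. Q (v 0) (v 1))"
      unfolding Q_def by (intro definable_intros definable_subst2[of G, OF G])
    then obtain S where S: "\<And>n x. rel S n x \<longleftrightarrow> n \<in> elts omega \<and> x \<in> elts B \<and> Q n x"
      by (rule ex_relation[of Q omega B]) (rule that)
    have "closed_under_step S"
      unfolding closed_under_step_def
    proof (intro conjI ballI impI)
      show "rel S omega_zero b" using S zero_omega b Q_def by blast
      fix n x m y
      assume *: "n \<in> elts omega" "x \<in> elts B" "rel S n x" "m \<in> elts omega" "y \<in> elts B"
        "elts m = insert n (elts n) \<and> G x y"
      have "Q n x" using *(3) S by blast
      then have "rel s n x"
        unfolding Q_def
      proof (elim disjE bexE exE conjE)
        fix k y assume "k \<in> elts omega" "rel s k y" "elts n = insert k (elts k)" "x \<in> elts B" "G y x"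
        then show ?thesis using s_step[of k y x] succ_eq_iff[of k n] by simp
      qed (simp add: s0)
      then have "Q m y" unfolding Q_def using * by blast
      then show "rel S m y" using S * by blast
    qed
    then have "rel S n x" using s nx by blast
    then have "Q n x" using S by blast
    then show ?thesis unfolding Q_def
    proof (elim disjE bexE exE conjE)
      fix k y assume "k \<in> elts omega" "rel s k y" "elts n = insert k (elts k)" "x \<in> elts B" "G y x"
      then show ?thesis using succ_eq_iff[of k n] by blast
    qed simp
  qed
  have ex: "\<exists>x\<in>elts B. rel s n x" if "n \<in> elts omega" for n
  proof -
    have "definable (\<lambda>v. \<exists>x\<in>elts B. rel s (v 0) x)" by (intro definable_intros)
    from this that show ?thesis
    proof (induction rule: omega_induct)
      case zero
      show ?case using s0 b by blast
    next
      case (succ n)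
      then show ?case using s_step step by blast
    qed
  qed
  have uniq: "\<forall>x y. rel s n x \<and> rel s n y \<longrightarrow> x = y" if "n \<in> elts omega" for n
  proof -
    have "definable (\<lambda>v. \<forall>x y. rel s (v 0) x \<and> rel s (v 0) y \<longrightarrow> x = y)"
      by (intro definable_intros)
    from this that show ?thesis
    proof (induction rule: omega_induct)
      case zero
      have "x = b" if "rel s omega_zero x" for x
        using s_inv[OF that] elts_succ elts_zero s by (metis insert_not_empty)
      then show ?case by metis
    next
      case (succ n)
      have *: "\<exists>z. rel s n z \<and> x \<in> elts B \<and> G z x" if "rel s (succ n) x" for x
        using s_inv[OF that]
      proof
        assume "succ n = omega_zero \<and> x = b"
        then show ?thesis using elts_succ[OF succ.hyps] by simp
      next
        assume "\<exists>k y. rel s k y \<and> succ n = succ k \<and> x \<in> elts B \<and> G y x"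
        then obtain k y where k: "rel s k y" "succ n = succ k" "x \<in> elts B" "G y x" by blast
        moreover have "n = k" using succ_inject[OF succ.hyps _ k(2)] s k(1) by blast
        ultimately show ?thesis by blast
      qed
      show ?case
      proof (intro allI impI)
        fix x y assume "rel s (succ n) x \<and> rel s (succ n) y"
        then obtain z z' where "rel s n z" "x \<in> elts B" "G z x" "rel s n z'" "y \<in> elts B" "G z' y"
          using * by blast
        moreover have "z \<in> elts B" "z = z'" using succ.IH s calculation by blast+
        ultimately show "x = y" using step[of z] by blast
      qed
    qed
  qed
  have fn: "is_function s omega B"
    unfolding is_function_def using s_pairs ex uniq by blast
  show ?thesis
  proof (rule that[OF fn])
    show "app s omega_zero = b" using function_rel_iff[OF fn zero_omega] s0 by simp
    show "G (app s n) (app s (succ n))" if n: "n \<in> elts omega" for n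
    proof -
      have "rel s n (app s n)" "app s n \<in> elts B"
        using function_rel_iff[OF fn n] function_app[OF fn n] by simp_all
      then show ?thesis
        using s_step step function_rel_iff[OF fn succ_omega[OF n]] by metis
    qed
  qed
qed

text \<open>
  The relation \<open>e\<close> indexes \<open>D\<close> injectively by natural numbers. The \<open>m\<close>-th term of the sequence is
  the greatest element among \<open>d0\<close> and the elements with an index in \<open>m\<close>. It is uniquely
  determined because the order is linear, and it exists by induction on \<open>m\<close>, as each step adds
  at most one element.
\<close>

lemma ex_cofinal_sequence:
  assumes lt: "definable (\<lambda>v. lt (v 0) (v 1))" and e: "definable (\<lambda>v. e (v 0) (v 1))"
    and irrefl: "\<And>x. x \<in> elts D \<Longrightarrow> \<not> lt x x"
    and trans: "\<And>x y z. \<lbrakk>x \<in> elts D; y \<in> elts D; z \<in> elts D; lt x y; lt y z\<rbrakk> \<Longrightarrow> lt x z"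
    and total: "\<And>x y. \<lbrakk>x \<in> elts D; y \<in> elts D\<rbrakk> \<Longrightarrow> lt x y \<or> x = y \<or> lt y x"
    and e_ex: "\<And>x. x \<in> elts D \<Longrightarrow> \<exists>k\<in>elts omega. e x k"
    and e_inj: "\<And>x y k. \<lbrakk>x \<in> elts D; y \<in> elts D; e x k; e y k\<rbrakk> \<Longrightarrow> x = y"
    and d0: "d0 \<in> elts D"
  obtains s where "is_function s omega D"
    and "\<And>d. d \<in> elts D \<Longrightarrow> \<exists>n\<in>elts omega. \<forall>m\<in>elts omega.
           n \<in> elts m \<or> n = m \<longrightarrow> d = app s m \<or> lt d (app s m)"
proof -
  define G where "G m y \<longleftrightarrow> (y = d0 \<or> (\<exists>k\<in>elts m. e y k)) \<and> (d0 = y \<or> lt d0 y) \<and>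
    (\<forall>d\<in>elts D. (\<exists>k\<in>elts m. e d k) \<longrightarrow> d = y \<or> lt d y)" for m y
  have G_def': "definable (\<lambda>v. G (v 0) (v 1))" and G_def'': "definable (\<lambda>v. \<exists>y\<in>elts D. G (v 0) y)"
    unfolding G_def
    by (intro definable_intros definable_subst2[of lt, OF lt] definable_subst2[of e, OF e])+
  have ex: "\<exists>y\<in>elts D. G m y" if "m \<in> elts omega" for m
    using G_def'' that
  proof (induction rule: omega_induct)
    case zero
    show ?case using d0 by (intro bexI[of _ d0]) (auto simp: G_def)
  next
    case (succ m)
    then obtain y where y: "y \<in> elts D" "G m y" by blast
    show ?case
    proof (cases "\<exists>d\<in>elts D. e d m \<and> lt y d")
      case True
      then obtain d where d: "d \<in> elts D" "e d m" "lt y d" by blast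
      have "d' = d \<or> lt d' d" if "d' \<in> elts D" "k \<in> elts (succ m)" "e d' k" for d' k
        using that y d trans[of d' y d] e_inj[of d' d m] elts_succ[OF succ.hyps]
        unfolding G_def by auto
      moreover have "lt d0 d" using y d d0 trans[of d0 y d] unfolding G_def by blast
      ultimately have "G (succ m) d"
        unfolding G_def using d elts_succ[OF succ.hyps] by auto
      then show ?thesis using d by blast
    next
      case False
      have "d = y \<or> lt d y" if "d \<in> elts D" "k \<in> elts (succ m)" "e d k" for d k
        using that False y total[of d y] elts_succ[OF succ.hyps] unfolding G_def by auto
      then have "G (succ m) y"
        using y elts_succ[OF succ.hyps] unfolding G_def by auto
      then show ?thesis using y by blast
    qed
  qed
  have uniq: "y = y'" if "y \<in> elts D" "y' \<in> elts D" "G m y" "G m y'" for m y y'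
  proof -
    have "y = y' \<or> lt y y'" "y' = y \<or> lt y' y" using that unfolding G_def by blast+
    then show ?thesis using trans[of y y' y] irrefl that by blast
  qed
  obtain s where s: "is_function s omega D"
    and sG: "\<And>m. m \<in> elts omega \<Longrightarrow> app s m \<in> elts D \<and> G m (app s m)"
    using ex_function[of G omega D] G_def' ex uniq by blast
  show ?thesis
  proof (rule that[OF s])
    fix d assume d: "d \<in> elts D"
    then obtain k where k: "k \<in> elts omega" "e d k" using e_ex by blast
    show "\<exists>n\<in>elts omega. \<forall>m\<in>elts omega.
           n \<in> elts m \<or> n = m \<longrightarrow> d = app s m \<or> lt d (app s m)"
    proof (intro bexI ballI impI)
      fix m assume m: "m \<in> elts omega" and le: "succ k \<in> elts m \<or> succ k = m"
      have "k \<in> elts (succ k)" using elts_succ[OF k(1)] by simp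
      then have "k \<in> elts m" using le omega_transitive(1)[OF m] by blast
      then show "d = app s m \<or> lt d (app s m)" using sG[OF m] d k(2) unfolding G_def by blast
    qed (rule succ_omega[OF k(1)])
  qed
qed

section \<open>Choice for closed sets\<close>

lemma ex_nonempty_closed_sets: "\<exists>F. elts F = {C. closed_set X T C \<and> elts C \<noteq> {}}"
proof -
  obtain P where P: "elts P = {C. elts C \<subseteq> elts X}" using power_set by blast
  have "definable (\<lambda>v. closed_set X T (v 0) \<and> elts (v 0) \<noteq> {})"
    unfolding closed_set_def set_eq_iff Diff_iff empty_iff by (intro definable_intros)
  then obtain F where "elts F = {C \<in> elts P. closed_set X T C \<and> elts C \<noteq> {}}"
    by (rule separation_definable)
  then show ?thesis unfolding P closed_set_def by (intro exI[of _ F]) auto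
qed

lemma AC_imp_Loeb:
  assumes AC "is_topology X T"
  shows "Loeb X T"
proof -
  obtain F where F: "elts F = {C. closed_set X T C \<and> elts C \<noteq> {}}"
    using ex_nonempty_closed_sets by blast
  then obtain c where "choice_function c F" using assms(1) unfolding AC_def by blast
  with F show ?thesis unfolding Loeb_def using assms(2) by blast
qed

lemma discrete_topology:
  assumes T: "elts T = {U. elts U \<subseteq> elts X}"
  shows "is_topology X T" and "sequential X T"
    and "elts C \<subseteq> elts X \<Longrightarrow> closed_set X T C"
proof -
  have ex: "\<exists>V\<in>elts T. elts V = {x \<in> elts X. P x}" if "definable (\<lambda>v. P (v 0))" for P
    using separation_definable[OF that, of X] T by (metis (no_types, lifting) mem_Collect_eq subsetI)
  show top: "is_topology X T"
    unfolding is_topology_def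
  proof (intro conjI ballI allI impI)
    show "elts U \<subseteq> elts X" if "U \<in> elts T" for U using that T by blast
    show "\<exists>e\<in>elts T. elts e = {}" by (rule bexI[of _ omega_zero]) (simp_all add: T)
    show "X \<in> elts T" using T by blast
    fix U V assume UV: "U \<in> elts T" "V \<in> elts T"
    have "definable (\<lambda>v. v 0 \<in> elts U \<and> v 0 \<in> elts V)" by (intro definable_intros)
    from ex[OF this] have "\<exists>W\<in>elts T. elts W = {x \<in> elts X. x \<in> elts U \<and> x \<in> elts V}" .
    moreover have "{x \<in> elts X. x \<in> elts U \<and> x \<in> elts V} = elts U \<inter> elts V"
      using UV T by auto
    ultimately show "\<exists>W\<in>elts T. elts W = elts U \<inter> elts V" by simp
  next
    fix S assume S: "elts S \<subseteq> elts T"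
    obtain W where W: "elts W = (\<Union>U\<in>elts S. elts U)" using union by blast
    then have "W \<in> elts T" using S T by auto
    with W show "\<exists>W\<in>elts T. elts W = (\<Union>U\<in>elts S. elts U)" by blast
  qed
  show closed: "closed_set X T C" if "elts C \<subseteq> elts X" for C
  proof -
    have "definable (\<lambda>v. v 0 \<notin> elts C)" by (intro definable_intros)
    from ex[OF this] have "\<exists>U\<in>elts T. elts U = elts X - elts C"
      by (simp add: set_diff_eq)
    then show ?thesis unfolding closed_set_def using that by blast
  qed
  show "sequential X T"
    unfolding sequential_def sequentially_closed_def using top closed by blast
qed

end

section \<open>Ordered field arithmetic\<close>

locale model_reals = zf_model +
  fixes R addR mulR zeroR oneR ltR
  assumes real_field: "real_field R addR mulR zeroR oneR ltR"
begin

abbreviation less (infix "\<prec>" 50) where "x \<prec> y \<equiv> rel ltR x y"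
abbreviation plus (infixl "\<oplus>\<^sub>R" 65) where "x \<oplus>\<^sub>R y \<equiv> app2 addR x y"
abbreviation times (infixl "\<otimes>\<^sub>R" 70) where "x \<otimes>\<^sub>R y \<equiv> app2 mulR x y"

definition K :: "'a ring" where
  "K = \<lparr>carrier = elts R, mult = app2 mulR, one = oneR, zero = zeroR, add = app2 addR\<rparr>"

sublocale K: field K
  using real_field unfolding real_field_def K_def by blast

lemma K_simps [simp]:
  "carrier K = elts R" "mult K = app2 mulR" "one K = oneR" "ring.zero K = zeroR" "add K = app2 addR"
  by (simp_all add: K_def)

abbreviation neg ("\<ominus>\<^sub>R _" [81] 80) where "\<ominus>\<^sub>R x \<equiv> \<ominus>\<^bsub>K\<^esub> x"

lemmas K_closed [simp, intro] =
  K.zero_closed[simplified] K.one_closed[simplified] K.a_closed[simplified]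
  K.m_closed[simplified] K.a_inv_closed[simplified]

lemma rel2_add: "x \<in> elts R \<Longrightarrow> y \<in> elts R \<Longrightarrow> rel2 addR x y z \<longleftrightarrow> z = x \<oplus>\<^sub>R y"
  and rel2_mul: "x \<in> elts R \<Longrightarrow> y \<in> elts R \<Longrightarrow> rel2 mulR x y z \<longleftrightarrow> z = x \<otimes>\<^sub>R y"
  using real_field function2_rel2_iff(1) unfolding real_field_def by metis+

lemma order_axioms:
  "\<forall>x\<in>elts R. \<not> x \<prec> x"
  "\<forall>x\<in>elts R. \<forall>y\<in>elts R. \<forall>z\<in>elts R. x \<prec> y \<and> y \<prec> z \<longrightarrow> x \<prec> z"
  "\<forall>x\<in>elts R. \<forall>y\<in>elts R. x \<prec> y \<or> x = y \<or> y \<prec> x"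
  "\<forall>x\<in>elts R. \<forall>y\<in>elts R. \<forall>z\<in>elts R. x \<prec> y \<longrightarrow> x \<oplus>\<^sub>R z \<prec> y \<oplus>\<^sub>R z"
  "\<forall>x\<in>elts R. \<forall>y\<in>elts R. zeroR \<prec> x \<and> zeroR \<prec> y \<longrightarrow> zeroR \<prec> x \<otimes>\<^sub>R y"
  by (insert real_field, unfold real_field_def) (elim conjE, assumption)+

lemma less_irrefl: "x \<in> elts R \<Longrightarrow> \<not> x \<prec> x"
  using order_axioms(1) by blast

lemma less_trans: "\<lbrakk>x \<in> elts R; y \<in> elts R; z \<in> elts R; x \<prec> y; y \<prec> z\<rbrakk> \<Longrightarrow> x \<prec> z"
  using order_axioms(2) by blast

lemma less_total: "\<lbrakk>x \<in> elts R; y \<in> elts R\<rbrakk> \<Longrightarrow> x \<prec> y \<or> x = y \<or> y \<prec> x"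
  using order_axioms(3) by blast

lemma add_right_mono: "\<lbrakk>x \<in> elts R; y \<in> elts R; z \<in> elts R; x \<prec> y\<rbrakk> \<Longrightarrow> x \<oplus>\<^sub>R z \<prec> y \<oplus>\<^sub>R z"
  using order_axioms(4) by blast

lemma mult_pos: "\<lbrakk>x \<in> elts R; y \<in> elts R; zeroR \<prec> x; zeroR \<prec> y\<rbrakk> \<Longrightarrow> zeroR \<prec> x \<otimes>\<^sub>R y"
  using order_axioms(5) by blast

lemma add_left_mono: "\<lbrakk>x \<in> elts R; y \<in> elts R; z \<in> elts R; x \<prec> y\<rbrakk> \<Longrightarrow> z \<oplus>\<^sub>R x \<prec> z \<oplus>\<^sub>R y"
  using add_right_mono K.a_comm by simp

lemma add_left_cancel:
  assumes "x \<in> elts R" "y \<in> elts R" "z \<in> elts R" "z \<oplus>\<^sub>R x = z \<oplus>\<^sub>R y"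
  shows "x = y"
  using less_total[of x y] add_left_mono[of x y z] add_left_mono[of y x z]
    less_irrefl[of "z \<oplus>\<^sub>R y"] assms by auto

lemma neg_pos: "x \<in> elts R \<Longrightarrow> x \<prec> zeroR \<Longrightarrow> zeroR \<prec> \<ominus>\<^sub>R x"
  using add_right_mono[of x zeroR "\<ominus>\<^sub>R x"] K.r_neg[of x] K.l_zero[of "\<ominus>\<^sub>R x"] by simp

lemma neg_neg: "x \<in> elts R \<Longrightarrow> zeroR \<prec> x \<Longrightarrow> \<ominus>\<^sub>R x \<prec> zeroR"
  using add_right_mono[of zeroR x "\<ominus>\<^sub>R x"] K.r_neg[of x] K.l_zero[of "\<ominus>\<^sub>R x"] by simp

lemma zero_less_oneR: "zeroR \<prec> oneR"
proof (rule ccontr)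
  assume "\<not> zeroR \<prec> oneR"
  then have "oneR \<prec> zeroR" using less_total[of zeroR oneR] K.one_not_zero by simp
  then have "zeroR \<prec> \<ominus>\<^sub>R oneR" by (simp add: neg_pos)
  then have "zeroR \<prec> (\<ominus>\<^sub>R oneR) \<otimes>\<^sub>R (\<ominus>\<^sub>R oneR)" by (simp add: mult_pos)
  moreover have "(\<ominus>\<^sub>R oneR) \<otimes>\<^sub>R (\<ominus>\<^sub>R oneR) = oneR"
    using K.l_minus[of oneR "\<ominus>\<^sub>R oneR"] K.l_one[of "\<ominus>\<^sub>R oneR"] K.minus_minus[of oneR] by simp
  ultimately show False using \<open>\<not> zeroR \<prec> oneR\<close> by simp
qed

text \<open>
  A number is small if it lies strictly between \<open>-2\<close> and \<open>2\<close>. Shifted by 2, the small numbers fill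
  the open interval from 0 to \<open>width = 4\<close>.
\<close>

definition two :: 'a where "two = oneR \<oplus>\<^sub>R oneR"

definition width :: 'a where "width = two \<oplus>\<^sub>R two"

definition small :: "'a \<Rightarrow> bool" where
  "small z \<longleftrightarrow> zeroR \<prec> z \<oplus>\<^sub>R two \<and> z \<oplus>\<^sub>R two \<prec> width"

lemma two_closed [simp, intro]: "two \<in> elts R"
  and width_closed [simp, intro]: "width \<in> elts R"
  by (simp_all add: two_def width_def)

lemma add_zeroR [simp]: "x \<in> elts R \<Longrightarrow> x \<oplus>\<^sub>R zeroR = x" "x \<in> elts R \<Longrightarrow> zeroR \<oplus>\<^sub>R x = x"
  using K.r_zero[of x] K.l_zero[of x] by simp_all

lemma one_less_two: "oneR \<prec> two"
  using add_left_mono[of zeroR oneR oneR] zero_less_oneR by (simp add: two_def)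

lemma zero_less_two: "zeroR \<prec> two"
  using less_trans[of zeroR oneR two] zero_less_oneR one_less_two by simp

lemma two_less_width: "two \<prec> width"
  using add_left_mono[of zeroR two two] zero_less_two by (simp add: width_def)

lemma zero_less_width: "zeroR \<prec> width"
  using less_trans[of zeroR two width] zero_less_two two_less_width by simp

lemma less_iff_diff_pos:
  assumes "x \<in> elts R" "y \<in> elts R"
  shows "x \<prec> y \<longleftrightarrow> zeroR \<prec> y \<oplus>\<^sub>R \<ominus>\<^sub>R x"
proof
  assume "x \<prec> y"
  then show "zeroR \<prec> y \<oplus>\<^sub>R \<ominus>\<^sub>R x"
    using add_right_mono[of x y "\<ominus>\<^sub>R x"] assms K.r_neg[of x] by simp
next
  assume "zeroR \<prec> y \<oplus>\<^sub>R \<ominus>\<^sub>R x"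
  then have "zeroR \<oplus>\<^sub>R x \<prec> (y \<oplus>\<^sub>R \<ominus>\<^sub>R x) \<oplus>\<^sub>R x"
    using assms by (intro add_right_mono) simp_all
  moreover have "(y \<oplus>\<^sub>R \<ominus>\<^sub>R x) \<oplus>\<^sub>R x = y"
    using K.a_assoc[of y "\<ominus>\<^sub>R x" x] K.l_neg[of x] assms by simp
  ultimately show "x \<prec> y" using assms by simp
qed

lemma ex_inverse_less_one:
  assumes x: "x \<in> elts R" and gt: "oneR \<prec> x"
  shows "\<exists>z\<in>elts R. z \<otimes>\<^sub>R x = oneR \<and> zeroR \<prec> z \<and> z \<prec> oneR"
proof -
  have x0: "zeroR \<prec> x" using less_trans[of zeroR oneR x] zero_less_oneR gt x by simp
  then have "x \<noteq> zeroR" using less_irrefl by auto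
  then have "x \<in> Units K" using K.field_Units x by simp
  then have "inv\<^bsub>K\<^esub> x \<in> elts R" "inv\<^bsub>K\<^esub> x \<otimes>\<^sub>R x = oneR"
    using K.Units_inv_closed K.Units_l_inv by simp_all
  then obtain z where z: "z \<in> elts R" "z \<otimes>\<^sub>R x = oneR" by blast
  have "z \<noteq> zeroR" using z K.l_null[of x] x K.one_not_zero by auto
  moreover have "\<not> z \<prec> zeroR"
  proof
    assume "z \<prec> zeroR"
    then have "zeroR \<prec> (\<ominus>\<^sub>R z) \<otimes>\<^sub>R x" using neg_pos mult_pos x0 x z by simp
    then have "zeroR \<prec> \<ominus>\<^sub>R oneR" using K.l_minus[of z x] z x by simp
    then show False
      using neg_neg[of oneR] zero_less_oneR less_trans[of zeroR "\<ominus>\<^sub>R oneR" zeroR] less_irrefl by simp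
  qed
  ultimately have z0: "zeroR \<prec> z" using less_total[of z zeroR] z by simp
  have "z \<noteq> oneR" using z K.l_one[of x] x gt less_irrefl[of oneR] by auto
  moreover have "\<not> oneR \<prec> z"
  proof
    assume "oneR \<prec> z"
    then have "zeroR \<prec> (z \<oplus>\<^sub>R \<ominus>\<^sub>R oneR) \<otimes>\<^sub>R x"
      using less_iff_diff_pos[of oneR z] mult_pos x0 x z by simp
    moreover have "(z \<oplus>\<^sub>R \<ominus>\<^sub>R oneR) \<otimes>\<^sub>R x = oneR \<oplus>\<^sub>R \<ominus>\<^sub>R x"
      using K.l_distr[of z "\<ominus>\<^sub>R oneR" x] K.l_minus[of oneR x] K.l_one[of x] z x by simp
    ultimately have "x \<prec> oneR" using less_iff_diff_pos[of x oneR] x by simp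
    then show False using gt less_trans[of x oneR x] less_irrefl x by simp
  qed
  ultimately have "z \<prec> oneR" using less_total[of z oneR] z by simp
  with z z0 show ?thesis by blast
qed

text \<open>
  A number that is not small has absolute value at least 2, hence greater than 1, and then the
  inverse has absolute value less than 1. The bound 2 keeps all these comparisons strict.
\<close>

lemma small_or_small_inverse:
  assumes x: "x \<in> elts R"
  shows "small x \<or> (\<exists>z\<in>elts R. small z \<and> z \<otimes>\<^sub>R x = oneR)"
proof (cases "small x")
  case False
  have less_width: "z \<oplus>\<^sub>R two \<prec> width" if "z \<in> elts R" "z \<prec> two" for z
    using add_right_mono[of z two two] that by (simp add: width_def)
  have not_less: "\<not> x \<prec> two \<or> \<not> zeroR \<prec> x \<oplus>\<^sub>R two"
    using False less_width x unfolding small_def by blast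
  show ?thesis
  proof (cases "oneR \<prec> x")
    case True
    then obtain z where z: "z \<in> elts R" "z \<otimes>\<^sub>R x = oneR" "zeroR \<prec> z" "z \<prec> oneR"
      using ex_inverse_less_one x by blast
    have "z \<prec> two" using less_trans[of z oneR two] z one_less_two by simp
    moreover have "zeroR \<prec> z \<oplus>\<^sub>R two"
      using add_right_mono[of zeroR z two] zero_less_two less_trans[of zeroR two "z \<oplus>\<^sub>R two"] z
      by simp
    ultimately have "small z" unfolding small_def using less_width z by blast
    with z show ?thesis by blast
  next
    case False
    have "x \<prec> two"
      using False less_total[of x oneR] less_trans[of x oneR two] one_less_two x by auto
    then have "\<not> zeroR \<prec> x \<oplus>\<^sub>R two" using not_less by blast
    moreover have "\<ominus>\<^sub>R (\<ominus>\<^sub>R x) = x" using K.minus_minus[of x] x by simp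
    ultimately have "\<not> \<ominus>\<^sub>R x \<prec> two"
      using less_iff_diff_pos[of "\<ominus>\<^sub>R x" two] K.a_comm[of x two] x by simp
    then have "oneR \<prec> \<ominus>\<^sub>R x"
      using less_total[of "\<ominus>\<^sub>R x" two] less_trans[of oneR two "\<ominus>\<^sub>R x"] one_less_two x by auto
    then obtain z where z: "z \<in> elts R" "z \<otimes>\<^sub>R \<ominus>\<^sub>R x = oneR" "zeroR \<prec> z" "z \<prec> oneR"
      using ex_inverse_less_one[of "\<ominus>\<^sub>R x"] x by auto
    have "(\<ominus>\<^sub>R z) \<otimes>\<^sub>R x = oneR"
      using z x K.l_minus[of z x] K.r_minus[of z x] by simp
    moreover have "z \<prec> two" using less_trans[of z oneR two] z one_less_two by simp
    then have "zeroR \<prec> \<ominus>\<^sub>R z \<oplus>\<^sub>R two"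
      using less_iff_diff_pos[of z two] K.a_comm[of two "\<ominus>\<^sub>R z"] z by simp
    moreover have "\<ominus>\<^sub>R z \<prec> two"
      using less_trans[of "\<ominus>\<^sub>R z" zeroR two] neg_neg[of z] zero_less_two z by simp
    then have "\<ominus>\<^sub>R z \<oplus>\<^sub>R two \<prec> width" using less_width z by simp
    ultimately show ?thesis unfolding small_def using z(1) by blast
  qed
qed blast

section \<open>Discrete spaces and the axiom of choice\<close>

text \<open>The metric takes the value 1 at all pairs of distinct points.\<close>

lemma discrete_metrizable:
  assumes T: "elts T = {U. elts U \<subseteq> elts X}"
  shows "metrizable R addR zeroR ltR X T"
proof -
  obtain P where P: "is_product P X X" using ex_product by blast
  define G where "G p z \<longleftrightarrow> ((\<exists>x. is_pair p x x) \<and> z = zeroR) \<or> (\<not> (\<exists>x. is_pair p x x) \<and> z = oneR)"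
    for p z
  have "definable (\<lambda>v. G (v 0) (v 1))" unfolding G_def by (intro definable_intros)
  moreover have "\<exists>!z. z \<in> elts R \<and> G p z" if "p \<in> elts P" for p
    unfolding G_def by (cases "\<exists>x. is_pair p x x") auto
  ultimately obtain d where d: "is_function d P R"
    and dG: "\<And>p. p \<in> elts P \<Longrightarrow> app d p \<in> elts R \<and> G p (app d p)"
    using ex_function[of G P R] by blast
  have d2: "is_function2 d X X R" unfolding is_function2_def using P d by blast
  have dist: "app2 d x y = (if x = y then zeroR else oneR)"
    if xy: "x \<in> elts X" "y \<in> elts X" for x y
  proof -
    obtain p where p: "is_pair p x y" using ex_pair by blast
    then have pP: "p \<in> elts P" using rel_product[OF P p] xy by blast
    have "rel2 d x y (app d p)"
      unfolding rel2_def using p function_rel_iff[OF d pP, of "app d p"]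
      by (intro exI[of _ p]) simp
    then have "app2 d x y = app d p" using function2_rel2_iff(1)[OF d2 xy, of "app d p"] by metis
    moreover have "G p (app d p)" using dG[OF pP] by blast
    ultimately show ?thesis
      unfolding G_def is_pair_diagonal[OF p] by (cases "x = y") simp_all
  qed
  have [simp]: "oneR \<noteq> zeroR" using K.one_not_zero by simp
  have "is_metric R addR zeroR ltR X d"
    unfolding is_metric_def
  proof (intro conjI ballI)
    show "is_function2 d X X R" by (rule d2)
    show "le ltR zeroR (app2 d x y)" "(app2 d x y = zeroR) = (x = y)" "app2 d x y = app2 d y x"
      if "x \<in> elts X" "y \<in> elts X" for x y
      using that zero_less_oneR by (auto simp: dist le_def)
    fix x y z assume xyz: "x \<in> elts X" "y \<in> elts X" "z \<in> elts X"
    consider "x = y" | "y = z" | "x \<noteq> y" "y \<noteq> z" by blast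
    then show "le ltR (app2 d x z) (app2 d x y \<oplus>\<^sub>R app2 d y z)"
    proof cases
      case 3
      then have "app2 d x y \<oplus>\<^sub>R app2 d y z = two" using dist xyz by (simp add: two_def)
      moreover have "app2 d x z = zeroR \<or> app2 d x z = oneR" using dist xyz by simp
      ultimately show ?thesis using zero_less_two one_less_two unfolding le_def by metis
    qed (use dist xyz in \<open>simp_all add: le_def\<close>)
  qed
  moreover have "elts T = {U. elts U \<subseteq> elts X \<and> (\<forall>x\<in>elts U. \<exists>e\<in>elts R. zeroR \<prec> e \<and>
      (\<forall>y\<in>elts X. app2 d x y \<prec> e \<longrightarrow> y \<in> elts U))}"
  proof -
    have "\<exists>e\<in>elts R. zeroR \<prec> e \<and> (\<forall>y\<in>elts X. app2 d x y \<prec> e \<longrightarrow> y \<in> elts U)"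
      if "elts U \<subseteq> elts X" "x \<in> elts U" for U x
    proof (intro bexI[of _ oneR] conjI ballI impI)
      fix y assume y: "y \<in> elts X" "app2 d x y \<prec> oneR"
      then have "x = y" using dist[of x y] that less_irrefl[of oneR] by (cases "x = y") auto
      then show "y \<in> elts U" using that by simp
    qed (simp_all add: zero_less_oneR)
    then show ?thesis unfolding T by blast
  qed
  ultimately show ?thesis
    unfolding metrizable_def using discrete_topology(1)[OF T] by blast
qed

lemma Loeb_imp_AC:
  assumes Loeb: "\<And>X T. metrizable R addR zeroR ltR X T \<Longrightarrow> sequential X T \<Longrightarrow> Loeb X T"
  shows AC
  unfolding AC_def
proof (intro allI impI)
  fix F assume F: "\<forall>A\<in>elts F. elts A \<noteq> {}"
  obtain X where X: "elts X = (\<Union>A\<in>elts F. elts A)" using union by blast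
  obtain T where T: "elts T = {U. elts U \<subseteq> elts X}" using power_set by blast
  have "Loeb X T" by (rule Loeb[OF discrete_metrizable[OF T] discrete_topology(2)[OF T]])
  then consider "elts X = {}" | F' c where "elts F' = {C. closed_set X T C \<and> elts C \<noteq> {}}"
    "choice_function c F'"
    unfolding Loeb_def by blast
  then show "\<exists>c. choice_function c F"
  proof cases
    case 1
    then have "elts F = {}" using X F by blast
    then show ?thesis by (rule choice_function_empty)
  next
    case 2
    have "elts F \<subseteq> elts F'"
    proof
      fix A assume A: "A \<in> elts F"
      then have "elts A \<subseteq> elts X" using X by blast
      then show "A \<in> elts F'" using 2(1) F A discrete_topology(3)[OF T] by simp
    qed
    then show ?thesis using choice_function_restrict 2(2) by blast
  qed
qed

section \<open>Subspaces of the real line\<close>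

text \<open>
  The open sets of the subspace \<open>X\<close> of the real line, described without reference to open sets of
  the line. Such a set is the trace of the union of all intervals whose trace it contains, so no
  witnessing intervals have to be chosen.
\<close>

definition locally_open :: "'a \<Rightarrow> 'a \<Rightarrow> bool" where
  "locally_open X U \<longleftrightarrow> elts U \<subseteq> elts X \<and>
     (\<forall>x\<in>elts U. \<exists>a\<in>elts R. \<exists>b\<in>elts R. a \<prec> x \<and> x \<prec> b \<and>
        (\<forall>y\<in>elts X. a \<prec> y \<and> y \<prec> b \<longrightarrow> y \<in> elts U))"

lemma locally_openI:
  assumes "elts U \<subseteq> elts X"
    and "\<And>x. x \<in> elts U \<Longrightarrow> \<exists>a\<in>elts R. \<exists>b\<in>elts R. a \<prec> x \<and> x \<prec> b \<and>
           (\<forall>y\<in>elts X. a \<prec> y \<and> y \<prec> b \<longrightarrow> y \<in> elts U)"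
  shows "locally_open X U"
  using assms unfolding locally_open_def by blast

lemma locally_openE:
  assumes "locally_open X U" "x \<in> elts U"
  obtains a b where "a \<in> elts R" "b \<in> elts R" "a \<prec> x" "x \<prec> b"
    "\<And>y. y \<in> elts X \<Longrightarrow> a \<prec> y \<Longrightarrow> y \<prec> b \<Longrightarrow> y \<in> elts U"
  using assms unfolding locally_open_def by meson

lemma usual_topology_iff: "usual_topology R ltR T \<longleftrightarrow> elts T = {U. locally_open R U}"
  unfolding usual_topology_def locally_open_def ..

lemma ex_locally_open_sets: "\<exists>S. elts S = {U. locally_open X U}"
proof -
  obtain P where P: "elts P = {U. elts U \<subseteq> elts X}" using power_set by blast
  have "definable (\<lambda>v. locally_open X (v 0))"
    unfolding locally_open_def by (intro definable_intros)
  then obtain S where "elts S = {U \<in> elts P. locally_open X U}"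
    by (rule separation_definable)
  then show ?thesis unfolding P locally_open_def by (intro exI[of _ S]) auto
qed

lemma subspace_locally_open:
  assumes X: "elts X \<subseteq> elts R" and T: "usual_topology R ltR T"
    and S: "elts S = {U. locally_open X U}"
  shows "is_subspace X S R T"
proof -
  have "locally_open X U \<longleftrightarrow> (\<exists>V\<in>elts T. elts U = elts V \<inter> elts X)" for U
  proof
    assume U: "locally_open X U"
    \<comment> \<open>The union of all intervals whose trace on \<open>X\<close> is contained in \<open>U\<close>.\<close>
    have "definable (\<lambda>v. \<exists>a\<in>elts R. \<exists>b\<in>elts R. a \<prec> v 0 \<and> v 0 \<prec> b \<and>
        (\<forall>y\<in>elts X. a \<prec> y \<and> y \<prec> b \<longrightarrow> y \<in> elts U))" by (intro definable_intros)
    then obtain V where V: "elts V = {z \<in> elts R. \<exists>a\<in>elts R. \<exists>b\<in>elts R. a \<prec> z \<and> z \<prec> b \<and>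
        (\<forall>y\<in>elts X. a \<prec> y \<and> y \<prec> b \<longrightarrow> y \<in> elts U)}" by (rule separation_definable)
    have "locally_open R V"
    proof (rule locally_openI)
      fix x assume "x \<in> elts V"
      then obtain a b where ab: "a \<in> elts R" "b \<in> elts R" "a \<prec> x" "x \<prec> b"
        "\<forall>y\<in>elts X. a \<prec> y \<and> y \<prec> b \<longrightarrow> y \<in> elts U" unfolding V by blast
      then have "\<forall>y\<in>elts R. a \<prec> y \<and> y \<prec> b \<longrightarrow> y \<in> elts V" unfolding V by blast
      with ab show "\<exists>a\<in>elts R. \<exists>b\<in>elts R. a \<prec> x \<and> x \<prec> b \<and>
        (\<forall>y\<in>elts R. a \<prec> y \<and> y \<prec> b \<longrightarrow> y \<in> elts V)" by blast
    qed (use V in blast)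
    moreover have "elts U = elts V \<inter> elts X"
    proof (intro subset_antisym subsetI)
      fix x assume x: "x \<in> elts U"
      then have xX: "x \<in> elts X" using U unfolding locally_open_def by blast
      then have "x \<in> elts V" using U x X unfolding locally_open_def V by blast
      with xX show "x \<in> elts V \<inter> elts X" by blast
    next
      fix x assume "x \<in> elts V \<inter> elts X"
      then show "x \<in> elts U" unfolding V by blast
    qed
    ultimately show "\<exists>V\<in>elts T. elts U = elts V \<inter> elts X"
      using T unfolding usual_topology_iff by blast
  next
    assume "\<exists>V\<in>elts T. elts U = elts V \<inter> elts X"
    then obtain V where V: "locally_open R V" "elts U = elts V \<inter> elts X"
      using T unfolding usual_topology_iff by blast
    show "locally_open X U"
    proof (rule locally_openI)
      fix x assume "x \<in> elts U"
      then have "x \<in> elts V" using V(2) by blast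
      with V(1) obtain a b where "a \<in> elts R" "b \<in> elts R" "a \<prec> x" "x \<prec> b"
        "\<And>y. y \<in> elts R \<Longrightarrow> a \<prec> y \<Longrightarrow> y \<prec> b \<Longrightarrow> y \<in> elts V" by (rule locally_openE) blast
      then show "\<exists>a\<in>elts R. \<exists>b\<in>elts R. a \<prec> x \<and> x \<prec> b \<and>
          (\<forall>y\<in>elts X. a \<prec> y \<and> y \<prec> b \<longrightarrow> y \<in> elts U)"
        using V(2) X by blast
    qed (use V(2) in blast)
  qed
  then show ?thesis unfolding is_subspace_def S using X by blast
qed

lemma ex_common_lower:
  assumes "a \<in> elts R" "a' \<in> elts R" "a \<prec> x" "a' \<prec> x"
  shows "\<exists>m\<in>elts R. m \<prec> x \<and> (\<forall>y\<in>elts R. m \<prec> y \<longrightarrow> a \<prec> y \<and> a' \<prec> y)"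
  using assms less_total[of a a'] less_trans by blast

lemma ex_common_upper:
  assumes "b \<in> elts R" "b' \<in> elts R" "x \<prec> b" "x \<prec> b'"
  shows "\<exists>m\<in>elts R. x \<prec> m \<and> (\<forall>y\<in>elts R. y \<prec> m \<longrightarrow> y \<prec> b \<and> y \<prec> b')"
  using assms less_total[of b b'] less_trans by blast

lemma ex_below: "x \<in> elts R \<Longrightarrow> \<exists>a\<in>elts R. a \<prec> x"
  using add_left_mono[of "\<ominus>\<^sub>R oneR" zeroR x] neg_neg[of oneR] zero_less_oneR
  by (intro bexI[of _ "x \<oplus>\<^sub>R \<ominus>\<^sub>R oneR"]) simp_all

lemma ex_above: "x \<in> elts R \<Longrightarrow> \<exists>b\<in>elts R. x \<prec> b"
  using add_left_mono[of zeroR oneR x] zero_less_oneR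
  by (intro bexI[of _ "x \<oplus>\<^sub>R oneR"]) simp_all

lemma locally_open_topology:
  assumes X: "elts X \<subseteq> elts R" and S: "elts S = {U. locally_open X U}"
  shows "is_topology X S"
  unfolding is_topology_def
proof (intro conjI ballI allI impI)
  show "elts U \<subseteq> elts X" if "U \<in> elts S" for U using that S locally_open_def by blast
  show "\<exists>e\<in>elts S. elts e = {}"
    by (rule bexI[of _ omega_zero]) (simp_all add: S locally_open_def)
  show "X \<in> elts S"
    unfolding S using X ex_below ex_above by (auto simp: locally_open_def)
  fix U V assume UV: "U \<in> elts S" "V \<in> elts S"
  have "definable (\<lambda>v. v 0 \<in> elts V)" by (intro definable_intros)
  then obtain W where W: "elts W = {x \<in> elts U. x \<in> elts V}" by (rule separation_definable)
  have UV': "locally_open X U" "locally_open X V" using UV S by blast+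
  have "locally_open X W"
  proof (rule locally_openI)
    show "elts W \<subseteq> elts X" using UV' unfolding W locally_open_def by blast
    fix x assume "x \<in> elts W"
    then have x: "x \<in> elts U" "x \<in> elts V" unfolding W by blast+
    from UV'(1) x(1) obtain a b where ab: "a \<in> elts R" "b \<in> elts R" "a \<prec> x" "x \<prec> b"
      "\<And>y. y \<in> elts X \<Longrightarrow> a \<prec> y \<Longrightarrow> y \<prec> b \<Longrightarrow> y \<in> elts U" by (rule locally_openE) blast
    from UV'(2) x(2) obtain a' b' where ab': "a' \<in> elts R" "b' \<in> elts R" "a' \<prec> x" "x \<prec> b'"
      "\<And>y. y \<in> elts X \<Longrightarrow> a' \<prec> y \<Longrightarrow> y \<prec> b' \<Longrightarrow> y \<in> elts V" by (rule locally_openE) blast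
    obtain l where l: "l \<in> elts R" "l \<prec> x" "\<forall>y\<in>elts R. l \<prec> y \<longrightarrow> a \<prec> y \<and> a' \<prec> y"
      using ex_common_lower[OF ab(1) ab'(1) ab(3) ab'(3)] by blast
    obtain u where u: "u \<in> elts R" "x \<prec> u" "\<forall>y\<in>elts R. y \<prec> u \<longrightarrow> y \<prec> b \<and> y \<prec> b'"
      using ex_common_upper[OF ab(2) ab'(2) ab(4) ab'(4)] by blast
    have "y \<in> elts W" if "y \<in> elts X" "l \<prec> y" "y \<prec> u" for y
      using that l u ab(5) ab'(5) X unfolding W by blast
    with l u show "\<exists>a\<in>elts R. \<exists>b\<in>elts R. a \<prec> x \<and> x \<prec> b \<and>
        (\<forall>y\<in>elts X. a \<prec> y \<and> y \<prec> b \<longrightarrow> y \<in> elts W)" by blast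
  qed
  then have "W \<in> elts S" unfolding S by simp
  moreover have "elts W = elts U \<inter> elts V" using W by blast
  ultimately show "\<exists>W\<in>elts S. elts W = elts U \<inter> elts V" by blast
next
  fix S' assume S': "elts S' \<subseteq> elts S"
  obtain W where W: "elts W = (\<Union>U\<in>elts S'. elts U)" using union by blast
  have "locally_open X W"
  proof (rule locally_openI)
    show "elts W \<subseteq> elts X" using S' unfolding W S locally_open_def by blast
    fix x assume "x \<in> elts W"
    then obtain U where U: "U \<in> elts S'" "x \<in> elts U" unfolding W by blast
    then have "locally_open X U" using S' S by blast
    from this U(2) obtain a b where "a \<in> elts R" "b \<in> elts R" "a \<prec> x" "x \<prec> b"
      "\<And>y. y \<in> elts X \<Longrightarrow> a \<prec> y \<Longrightarrow> y \<prec> b \<Longrightarrow> y \<in> elts U" by (rule locally_openE) blast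
    then show "\<exists>a\<in>elts R. \<exists>b\<in>elts R. a \<prec> x \<and> x \<prec> b \<and>
        (\<forall>y\<in>elts X. a \<prec> y \<and> y \<prec> b \<longrightarrow> y \<in> elts W)" using U(1) unfolding W by blast
  qed
  with W show "\<exists>W\<in>elts S. elts W = (\<Union>U\<in>elts S'. elts U)" unfolding S by blast
qed

text \<open>
  The left and the right side are treated together: \<open>lt\<close> is the order of the reals or its converse,
  and \<open>a\<close> bounds a gap next to \<open>x\<close> on the side below \<open>x\<close> in the sense of \<open>lt\<close>. Without such a gap, the
  points of \<open>C\<close> with property \<open>Q\<close> on that side accumulate at \<open>x\<close>. Since \<open>e\<close> indexes them by natural
  numbers, there is a cofinal sequence among them; it converges to \<open>x\<close>, which forces \<open>x\<close> into \<open>C\<close>.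
\<close>

lemma no_one_sided_limit:
  assumes X: "elts X \<subseteq> elts R" and S: "elts S = {U. locally_open X U}"
    and C: "sequentially_closed X S C" and x: "x \<in> elts X" "x \<notin> elts C"
    and lt: "lt = (\<lambda>a b. a \<prec> b) \<or> lt = (\<lambda>a b. b \<prec> a)"
    and Q: "definable (\<lambda>v. Q (v 0))" and e: "definable (\<lambda>v. e (v 0) (v 1))"
    and e_ex: "\<And>y. Q y \<Longrightarrow> \<exists>k\<in>elts omega. e y k"
    and e_inj: "\<And>y z k. Q y \<Longrightarrow> Q z \<Longrightarrow> e y k \<Longrightarrow> e z k \<Longrightarrow> y = z"
  shows "\<exists>a\<in>elts R. lt a x \<and> (\<forall>y\<in>elts C. Q y \<longrightarrow> \<not> (lt a y \<and> lt y x))"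
proof (rule ccontr)
  assume neg: "\<not> ?thesis"
  have CX: "elts C \<subseteq> elts X" using C unfolding sequentially_closed_def by blast
  have xR: "x \<in> elts R" using x X by blast
  have lt_def: "definable (\<lambda>v. lt (v 0) (v 1))"
    using lt by (elim disjE) (simp_all only:, (intro definable_intros)+)
  have lt_irrefl: "\<not> lt a a" if "a \<in> elts R" for a using lt less_irrefl that by blast
  have lt_trans: "lt a c" if "a \<in> elts R" "b \<in> elts R" "c \<in> elts R" "lt a b" "lt b c" for a b c
    using lt less_trans[of a b c] less_trans[of c b a] that by auto
  have lt_total: "lt a b \<or> a = b \<or> lt b a" if "a \<in> elts R" "b \<in> elts R" for a b
    using lt less_total[of a b] that by auto
  have lt_ex: "\<exists>a\<in>elts R. lt a x" using lt ex_below[OF xR] ex_above[OF xR] by auto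
  have approach: "\<exists>y\<in>elts C. Q y \<and> lt a y \<and> lt y x" if "a \<in> elts R" "lt a x" for a
    using neg that by blast
  have "definable (\<lambda>v. Q (v 0) \<and> lt (v 0) x)"
    by (intro definable_and Q definable_subst2[of lt, OF lt_def] simple_term_var simple_term_param)
  then obtain D where D: "elts D = {y \<in> elts C. Q y \<and> lt y x}" by (rule separation_definable)
  have DR: "y \<in> elts R" if "y \<in> elts D" for y using that D CX X by blast
  obtain d0 where d0: "d0 \<in> elts D" using lt_ex approach unfolding D by blast
  obtain s where s: "is_function s omega D"
    and cofinal: "\<And>d. d \<in> elts D \<Longrightarrow> \<exists>n\<in>elts omega. \<forall>m\<in>elts omega.
           n \<in> elts m \<or> n = m \<longrightarrow> d = app s m \<or> lt d (app s m)"
  proof (rule ex_cofinal_sequence[of lt e D d0, OF lt_def e _ _ _ _ _ d0])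
    show "\<not> lt a a" if "a \<in> elts D" for a using lt_irrefl DR that by blast
    show "lt a c" if "a \<in> elts D" "b \<in> elts D" "c \<in> elts D" "lt a b" "lt b c" for a b c
      using lt_trans DR that by blast
    show "lt a b \<or> a = b \<or> lt b a" if "a \<in> elts D" "b \<in> elts D" for a b
      using lt_total DR that by blast
    show "\<exists>k\<in>elts omega. e a k" if "a \<in> elts D" for a using e_ex that D by blast
    show "a = b" if "a \<in> elts D" "b \<in> elts D" "e a k" "e b k" for a b k
      using e_inj that D by blast
  qed (rule that)
  have "converges X S s x"
    unfolding converges_def
  proof (intro conjI ballI impI)
    show "x \<in> elts X" by (rule x(1))
    fix U assume U: "U \<in> elts S" "x \<in> elts U"
    then have "locally_open X U" using S by blast
    from this U(2) obtain a b where ab: "a \<in> elts R" "b \<in> elts R" "a \<prec> x" "x \<prec> b"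
      "\<And>y. y \<in> elts X \<Longrightarrow> a \<prec> y \<Longrightarrow> y \<prec> b \<Longrightarrow> y \<in> elts U" by (rule locally_openE) blast
    have "\<exists>p\<in>elts R. \<exists>q\<in>elts R. lt p x \<and> lt x q \<and>
        (\<forall>y\<in>elts X. lt p y \<and> lt y q \<longrightarrow> y \<in> elts U)"
      using lt
    proof
      assume "lt = (\<lambda>a b. a \<prec> b)"
      then show ?thesis using ab by (intro bexI[of _ a] bexI[of _ b]) auto
    next
      assume "lt = (\<lambda>a b. b \<prec> a)"
      then show ?thesis using ab by (intro bexI[of _ b] bexI[of _ a]) auto
    qed
    then obtain p q where p: "p \<in> elts R" "lt p x" and q: "q \<in> elts R" "lt x q"
      and pq: "\<And>y. y \<in> elts X \<Longrightarrow> lt p y \<Longrightarrow> lt y q \<Longrightarrow> y \<in> elts U" by blast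
    obtain d where d: "d \<in> elts D" "lt p d" using approach[OF p] unfolding D by blast
    then obtain n where n: "n \<in> elts omega"
      "\<forall>m\<in>elts omega. n \<in> elts m \<or> n = m \<longrightarrow> d = app s m \<or> lt d (app s m)"
      using cofinal by blast
    have "app s m \<in> elts U" if m: "m \<in> elts omega" "n \<in> elts m \<or> n = m" for m
    proof (rule pq)
      have smD: "app s m \<in> elts D" using function_app[OF s m(1)] .
      then show "app s m \<in> elts X" using D CX by blast
      show "lt p (app s m)" using n(2) m d lt_trans[of p d "app s m"] p(1) DR smD by blast
      show "lt (app s m) q" using lt_trans[of "app s m" x q] smD DR D xR q by blast
    qed
    with n(1) show "\<exists>n\<in>elts omega. \<forall>m\<in>elts omega. n \<in> elts m \<or> n = m \<longrightarrow> app s m \<in> elts U"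
      by blast
  qed
  moreover have "is_function s omega C"
    using s D unfolding is_function_def by blast
  ultimately have "x \<in> elts C" using C unfolding sequentially_closed_def by blast
  then show False using x(2) by blast
qed

section \<open>Choice from codes in disjoint intervals\<close>

text \<open>
  \<open>E A x y\<close> means that the real \<open>y\<close> is a code of the point \<open>x\<close> of \<open>A\<close>. The codes for \<open>A\<close> lie in an open
  interval that contains no codes for other members of \<open>F\<close>, and they are countable like \<open>A\<close>; so the
  set of all codes is a sequential subspace in which the codes for each \<open>A\<close> form a closed set. A
  point chosen from this closed set is the code of a unique point of \<open>A\<close>.
\<close>

lemma ex_choice_from_separated_codes:
  assumes Loeb: "\<And>T X S. usual_topology R ltR T \<Longrightarrow> is_subspace X S R T \<Longrightarrow>
      sequential X S \<Longrightarrow> Loeb X S"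
    and E: "definable (\<lambda>v. E (v 0) (v 1) (v 2))"
    and interval: "\<And>A. A \<in> elts F \<Longrightarrow> lo A \<in> elts R \<and> hi A \<in> elts R"
    and range: "\<And>A x y. A \<in> elts F \<Longrightarrow> E A x y \<Longrightarrow>
      x \<in> elts A \<and> y \<in> elts R \<and> lo A \<prec> y \<and> y \<prec> hi A"
    and separated: "\<And>A A' x y. \<lbrakk>A \<in> elts F; A' \<in> elts F; E A' x y; lo A \<prec> y; y \<prec> hi A\<rbrakk> \<Longrightarrow> A' = A"
    and inj: "\<And>A x x' y. \<lbrakk>A \<in> elts F; E A x y; E A x' y\<rbrakk> \<Longrightarrow> x = x'"
    and functional: "\<And>A x y y'. \<lbrakk>A \<in> elts F; E A x y; E A x y'\<rbrakk> \<Longrightarrow> y = y'"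
    and nonempty: "\<And>A. A \<in> elts F \<Longrightarrow> \<exists>x y. E A x y"
    and countable: "\<And>A. A \<in> elts F \<Longrightarrow> is_countable A"
  shows "\<exists>c. choice_function c F"
proof -
  note E_intro = definable_subst3[of E, OF E]
  have "definable (\<lambda>v. \<exists>A\<in>elts F. \<exists>x. E A x (v 0))" by (intro definable_intros E_intro)
  then obtain X where X: "elts X = {y \<in> elts R. \<exists>A\<in>elts F. \<exists>x. E A x y}"
    by (rule separation_definable)
  have XR: "elts X \<subseteq> elts R" unfolding X by blast
  obtain T where T: "usual_topology R ltR T"
    unfolding usual_topology_iff using ex_locally_open_sets by blast
  obtain S where S: "elts S = {U. locally_open X U}" using ex_locally_open_sets by blast
  have top: "is_topology X S" by (rule locally_open_topology[OF XR S])
  have closedI: "closed_set X S C"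
    if CX: "elts C \<subseteq> elts X" and
      sep: "\<And>x. x \<in> elts X \<Longrightarrow> x \<notin> elts C \<Longrightarrow> \<exists>a\<in>elts R. \<exists>b\<in>elts R. a \<prec> x \<and> x \<prec> b \<and>
        (\<forall>y\<in>elts X. a \<prec> y \<and> y \<prec> b \<longrightarrow> y \<notin> elts C)" for C
  proof -
    have "definable (\<lambda>v. v 0 \<notin> elts C)" by (intro definable_intros)
    then obtain U where U: "elts U = {x \<in> elts X. x \<notin> elts C}" by (rule separation_definable)
    have "locally_open X U"
    proof (rule locally_openI)
      fix x assume "x \<in> elts U"
      then have "x \<in> elts X" "x \<notin> elts C" unfolding U by blast+
      from sep[OF this] show "\<exists>a\<in>elts R. \<exists>b\<in>elts R. a \<prec> x \<and> x \<prec> b \<and>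
        (\<forall>y\<in>elts X. a \<prec> y \<and> y \<prec> b \<longrightarrow> y \<in> elts U)" unfolding U by blast
    qed (use U in blast)
    then have "U \<in> elts S" unfolding S by simp
    then show ?thesis unfolding closed_set_def using CX U by blast
  qed
  have "sequential X S"
    unfolding sequential_def
  proof (intro conjI allI impI)
    fix C assume C: "sequentially_closed X S C"
    then have CX: "elts C \<subseteq> elts X" unfolding sequentially_closed_def by blast
    show "closed_set X S C"
    proof (rule closedI[OF CX])
      fix x assume x: "x \<in> elts X" "x \<notin> elts C"
      then obtain A x0 where A: "A \<in> elts F" "E A x0 x" unfolding X by blast
      obtain B f where B: "elts B \<subseteq> elts omega" and f: "is_bijection f A B"
        using countable[OF A(1)] unfolding is_countable_def by blast
      have fn: "is_function f A B" and f_inj: "inj_on (app f) (elts A)"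
        using f unfolding is_bijection_def bij_betw_def by blast+
      define Q where "Q y \<longleftrightarrow> (\<exists>x. E A x y)" for y
      define e where "e y k \<longleftrightarrow> (\<exists>x. E A x y \<and> rel f x k)" for y k
      have Qdef: "definable (\<lambda>v. Q (v 0))" and edef: "definable (\<lambda>v. e (v 0) (v 1))"
        unfolding Q_def e_def by (intro definable_intros E_intro)+
      have e_ex: "\<exists>k\<in>elts omega. e y k" if Qy: "Q y" for y
      proof -
        obtain z where z: "E A z y" using Qy unfolding Q_def by blast
        then have zA: "z \<in> elts A" using range A(1) by blast
        have "rel f z (app f z)" using function_rel_iff[OF fn zA] by simp
        moreover have "app f z \<in> elts omega" using function_app[OF fn zA] B by blast
        ultimately show ?thesis unfolding e_def using z by blast
      qed
      have e_inj: "y = y'" if ek: "e y k" "e y' k" for y y' k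
      proof -
        obtain z z' where z: "E A z y" "rel f z k" "E A z' y'" "rel f z' k"
          using ek unfolding e_def by blast
        then have "z \<in> elts A" "z' \<in> elts A" using range A(1) by blast+
        then have "z = z'"
          using z(2,4) function_rel_iff[OF fn] inj_onD[OF f_inj, of z z'] by simp
        then show ?thesis using functional[OF A(1) z(1)] z(3) by blast
      qed
      have one_sided: "\<exists>a\<in>elts R. lt a x \<and> (\<forall>y\<in>elts C. Q y \<longrightarrow> \<not> (lt a y \<and> lt y x))"
        if "lt = (\<lambda>a b. a \<prec> b) \<or> lt = (\<lambda>a b. b \<prec> a)" for lt
        by (rule no_one_sided_limit[of X S C x lt Q e, OF XR S C x that Qdef edef e_ex e_inj])
      obtain a where a: "a \<in> elts R" "a \<prec> x" "\<forall>y\<in>elts C. Q y \<longrightarrow> \<not> (a \<prec> y \<and> y \<prec> x)"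
        using one_sided[of "\<lambda>a b. a \<prec> b"] by blast
      obtain b where b: "b \<in> elts R" "x \<prec> b" "\<forall>y\<in>elts C. Q y \<longrightarrow> \<not> (y \<prec> b \<and> x \<prec> y)"
        using one_sided[of "\<lambda>a b. b \<prec> a"] by blast
      \<comment> \<open>Between \<open>lo A\<close> and \<open>hi A\<close> all codes belong to \<open>A\<close>, so the two gaps exclude the whole of \<open>C\<close>.\<close>
      have lohi: "lo A \<prec> x" "x \<prec> hi A" "lo A \<in> elts R" "hi A \<in> elts R"
        using range[OF A] interval[OF A(1)] by blast+
      obtain l where l: "l \<in> elts R" "l \<prec> x" "\<forall>y\<in>elts R. l \<prec> y \<longrightarrow> a \<prec> y \<and> lo A \<prec> y"
        using ex_common_lower[OF a(1) lohi(3) a(2) lohi(1)] by blast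
      obtain u where u: "u \<in> elts R" "x \<prec> u" "\<forall>y\<in>elts R. y \<prec> u \<longrightarrow> y \<prec> b \<and> y \<prec> hi A"
        using ex_common_upper[OF b(1) lohi(4) b(2) lohi(2)] by blast
      have "y \<notin> elts C" if y: "y \<in> elts X" "l \<prec> y" "y \<prec> u" for y
      proof
        assume yC: "y \<in> elts C"
        have yR: "y \<in> elts R" using y XR by blast
        obtain A' z where "A' \<in> elts F" "E A' z y" using y(1) unfolding X by blast
        then have "Q y" using separated[OF A(1)] l(3) u(3) y yR unfolding Q_def by blast
        then have "\<not> y \<prec> x" "\<not> x \<prec> y" using a(3) b(3) l(3) u(3) y yR yC by blast+
        then have "y = x" using less_total x(1) XR yR by blast
        then show False using yC x(2) by blast
      qed
      then show "\<exists>a\<in>elts R. \<exists>b\<in>elts R. a \<prec> x \<and> x \<prec> b \<and>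
          (\<forall>y\<in>elts X. a \<prec> y \<and> y \<prec> b \<longrightarrow> y \<notin> elts C)" using l(1,2) u(1,2) by blast
    qed
  qed (rule top)
  then have "Loeb X S" using Loeb[OF T subspace_locally_open[OF XR T S]] by blast
  then consider "elts X = {}" | H c where "elts H = {C. closed_set X S C \<and> elts C \<noteq> {}}"
    "choice_function c H"
    unfolding Loeb_def by blast
  then show ?thesis
  proof cases
    case 1
    then have "elts F = {}" using nonempty range X by blast
    then show ?thesis by (rule choice_function_empty)
  next
    case 2
    \<comment> \<open>The quantified \<open>C\<close> is the set of all codes for \<open>A\<close>, and \<open>y\<close> is the code chosen from it.\<close>
    define G where "G A x \<longleftrightarrow>
      (\<exists>C y. (\<forall>z. z \<in> elts C \<longleftrightarrow> (\<exists>x. E A x z)) \<and> rel c C y \<and> E A x y)" for A x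
    have "definable (\<lambda>v. G (v 0) (v 1))" unfolding G_def by (intro definable_intros E_intro)
    moreover have "\<exists>!x. x \<in> elts A \<and> G A x" if A: "A \<in> elts F" for A
    proof -
      have "definable (\<lambda>v. \<exists>x. E A x (v 0))" by (intro definable_intros E_intro)
      then obtain C where C: "elts C = {y \<in> elts X. \<exists>x. E A x y}" by (rule separation_definable)
      have C': "z \<in> elts C \<longleftrightarrow> (\<exists>x. E A x z)" for z
        unfolding C X using range A by blast
      have C_unique: "C' = C" if "\<forall>z. z \<in> elts C' \<longleftrightarrow> (\<exists>x. E A x z)" for C'
        using that C' by (intro extensionality) blast
      have "closed_set X S C"
      proof (rule closedI)
        show "elts C \<subseteq> elts X" unfolding C by blast
        fix x assume x: "x \<in> elts X" "x \<notin> elts C"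
        then obtain A' x0 where A': "A' \<in> elts F" "E A' x0 x" unfolding X by blast
        have "y \<notin> elts C" if "lo A' \<prec> y" "y \<prec> hi A'" for y
          using separated[OF A'(1) A _ that] x(2) C' A' by blast
        then show "\<exists>a\<in>elts R. \<exists>b\<in>elts R. a \<prec> x \<and> x \<prec> b \<and>
            (\<forall>y\<in>elts X. a \<prec> y \<and> y \<prec> b \<longrightarrow> y \<notin> elts C)"
          using range[OF A'] interval[OF A'(1)] by blast
      qed
      then have CH: "C \<in> elts H" using 2(1) nonempty[OF A] C' by blast
      obtain B where c: "is_function c H B" "app c C \<in> elts C"
        using 2(2) CH unfolding choice_function_def by blast
      have rel_c: "rel c C y \<longleftrightarrow> y = app c C" for y by (rule function_rel_iff[OF c(1) CH])
      obtain x where x: "E A x (app c C)" using c(2) C' by blast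
      have "G A x" unfolding G_def using C' rel_c x by blast
      moreover have "x' = x" if "G A x'" for x'
      proof -
        obtain C' y where "\<forall>z. z \<in> elts C' \<longleftrightarrow> (\<exists>x. E A x z)" "rel c C' y" "E A x' y"
          using \<open>G A x'\<close> unfolding G_def by blast
        then have "E A x' (app c C)" using C_unique rel_c by metis
        then show ?thesis using inj[OF A] x by blast
      qed
      ultimately show ?thesis using x range[OF A] by blast
    qed
    ultimately show ?thesis by (rule ex_choice_function)
  qed
qed

section \<open>Coding countably many sets of reals\<close>

text \<open>The multiples of \<open>width\<close>, by recursion inside the model.\<close>

lemma ex_spaced_sequence:
  obtains W where "is_function W omega R"
    and "\<And>m n. m \<in> elts omega \<Longrightarrow> n \<in> elts m \<Longrightarrow>
      app W n \<oplus>\<^sub>R width \<prec> app W m \<or> app W n \<oplus>\<^sub>R width = app W m"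
proof -
  have step: "definable (\<lambda>v. rel2 addR (v 0) width (v 1))" by (intro definable_intros)
  obtain W where W: "is_function W omega R"
    and W_succ: "\<And>n. n \<in> elts omega \<Longrightarrow> rel2 addR (app W n) width (app W (succ n))"
  proof (rule omega_recursion[of "\<lambda>x y. rel2 addR x width y", OF step])
    show "zeroR \<in> elts R" by simp
    show "\<exists>!y. y \<in> elts R \<and> rel2 addR x width y" if "x \<in> elts R" for x
      using rel2_add[OF that width_closed] that by auto
  qed (rule that)
  have WR: "app W n \<in> elts R" if "n \<in> elts omega" for n by (rule function_app[OF W that])
  have W_succ': "app W (succ n) = app W n \<oplus>\<^sub>R width" if "n \<in> elts omega" for n
    using W_succ[OF that] rel2_add WR[OF that] by simp
  \<comment> \<open>The spacing property in terms of graphs, in which form it is visibly definable.\<close>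
  define P where "P m \<longleftrightarrow> (\<forall>n\<in>elts m. \<forall>x\<in>elts R. \<forall>y\<in>elts R. \<forall>u.
    rel W n x \<and> rel W m y \<and> rel2 addR x width u \<longrightarrow> u \<prec> y \<or> u = y)" for m
  have P_iff: "P m \<longleftrightarrow> (\<forall>n\<in>elts m. app W n \<oplus>\<^sub>R width \<prec> app W m \<or> app W n \<oplus>\<^sub>R width = app W m)"
    if m: "m \<in> elts omega" for m
  proof -
    have "rel W n x \<longleftrightarrow> x = app W n" "app W n \<in> elts R" if "n \<in> elts m" for n x
      using function_rel_iff[OF W] WR omega_transitive(2)[OF m that] by blast+
    moreover have "rel W m y \<longleftrightarrow> y = app W m" for y by (rule function_rel_iff[OF W m])
    ultimately show ?thesis unfolding P_def using WR[OF m] rel2_add[OF _ width_closed] by auto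
  qed
  have "definable (\<lambda>v. P (v 0))" unfolding P_def by (intro definable_intros)
  from this have "P m" if "m \<in> elts omega" for m
    using that
  proof (induction rule: omega_induct)
    case zero
    show ?case unfolding P_def by simp
  next
    case (succ m)
    have less: "app W m \<prec> app W (succ m)"
      using add_left_mono[of zeroR width "app W m"] zero_less_width WR succ.hyps W_succ' by simp
    have "app W n \<oplus>\<^sub>R width \<prec> app W (succ m)" if n: "n \<in> elts m" for n
    proof -
      have "app W n \<in> elts R" using WR omega_transitive(2)[OF succ.hyps n] by blast
      moreover have "app W n \<oplus>\<^sub>R width \<prec> app W m \<or> app W n \<oplus>\<^sub>R width = app W m"
        using succ.IH P_iff[OF succ.hyps] n by blast
      ultimately show ?thesis
        using less less_trans[of "app W n \<oplus>\<^sub>R width" "app W m" "app W (succ m)"]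
          WR succ.hyps succ_omega by auto
    qed
    then show ?case
      unfolding P_iff[OF succ_omega[OF succ.hyps]] elts_succ[OF succ.hyps]
      using W_succ'[OF succ.hyps] by auto
  qed
  then show ?thesis using that[OF W] P_iff by blast
qed

text \<open>
  The \<open>n\<close>-th member of \<open>F\<close> is coded in the open interval of length \<open>width\<close> that starts at the
  \<open>n\<close>-th term of the spaced sequence. A point \<open>x\<close> of \<open>A\<close> is represented by a small number, namely by
  itself if it is small, and by its inverse if \<open>A\<close> contains no small number at all; the case
  distinction concerns \<open>A\<close> and not \<open>x\<close>, so that a number and its inverse cannot collide.
\<close>

lemma Loeb_imp_CAC_omega:
  assumes Loeb: "\<And>T X S. usual_topology R ltR T \<Longrightarrow> is_subspace X S R T \<Longrightarrow>
      sequential X S \<Longrightarrow> Loeb X S"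
  shows "CAC_omega R"
  unfolding CAC_omega_def
proof (intro allI impI, elim conjE)
  fix F
  assume "is_countable F"
    and F: "\<forall>A\<in>elts F. elts A \<subseteq> elts R \<and> elts A \<noteq> {} \<and> is_countable A"
  then obtain B h where B: "elts B \<subseteq> elts omega" and h: "is_bijection h F B"
    unfolding is_countable_def by blast
  have hfn: "is_function h F B" and h_inj: "inj_on (app h) (elts F)"
    using h unfolding is_bijection_def bij_betw_def by blast+
  obtain W where W: "is_function W omega R"
    and spaced: "\<And>m n. m \<in> elts omega \<Longrightarrow> n \<in> elts m \<Longrightarrow>
      app W n \<oplus>\<^sub>R width \<prec> app W m \<or> app W n \<oplus>\<^sub>R width = app W m"
    using ex_spaced_sequence by blast
  define lo where "lo A = app W (app h A)" for A
  define hi where "hi A = lo A \<oplus>\<^sub>R width" for A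
  have hA: "app h A \<in> elts omega" if "A \<in> elts F" for A
    using function_app[OF hfn that] B by blast
  have loR: "lo A \<in> elts R" if "A \<in> elts F" for A
    unfolding lo_def by (rule function_app[OF W hA[OF that]])
  have hiR: "hi A \<in> elts R" if "A \<in> elts F" for A
    unfolding hi_def using loR[OF that] by simp
  have "definable (\<lambda>v. \<exists>u. rel2 addR (v 0) two u \<and> zeroR \<prec> u \<and> u \<prec> width)"
    by (intro definable_intros)
  then obtain Sm where "elts Sm = {z \<in> elts R. \<exists>u. rel2 addR z two u \<and> zeroR \<prec> u \<and> u \<prec> width}"
    by (rule separation_definable)
  then have Sm: "elts Sm = {z \<in> elts R. small z}"
    unfolding small_def using rel2_add[OF _ two_closed] by auto
  define E where "E A x y \<longleftrightarrow> x \<in> elts A \<and> (\<exists>n r z u. rel h A n \<and> rel W n r \<and> z \<in> elts Sm \<and>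
    (x = z \<or> (\<forall>x'\<in>elts A. x' \<notin> elts Sm) \<and> rel2 mulR z x oneR) \<and>
    rel2 addR z two u \<and> rel2 addR r u y)" for A x y
  \<comment> \<open>\<open>E\<close> is stated with graphs of operations so as to be definable; \<open>code\<close> is its content.\<close>
  define code where "code A x z \<longleftrightarrow> z \<in> elts R \<and> small z \<and>
    (x = z \<or> (\<forall>x'\<in>elts A. \<not> small x') \<and> z \<otimes>\<^sub>R x = oneR)" for A x z
  have E_iff: "E A x y \<longleftrightarrow> x \<in> elts A \<and> (\<exists>z. code A x z \<and> y = lo A \<oplus>\<^sub>R (z \<oplus>\<^sub>R two))"
    if A: "A \<in> elts F" for A x y
  proof -
    have AR: "elts A \<subseteq> elts R" using F A by blast
    have 1: "rel h A n \<and> rel W n r \<longleftrightarrow> n = app h A \<and> r = lo A" for n r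
      unfolding lo_def function_rel_iff[OF hfn A]
      using function_rel_iff[OF W hA[OF A], of r] by auto
    have 2: "rel2 addR z two u \<and> rel2 addR (lo A) u y \<longleftrightarrow> u = z \<oplus>\<^sub>R two \<and> y = lo A \<oplus>\<^sub>R (z \<oplus>\<^sub>R two)"
      if "z \<in> elts R" for z u
      using rel2_add[OF that two_closed] rel2_add[OF loR[OF A], of "z \<oplus>\<^sub>R two"] that by auto
    have 3: "code A x z \<longleftrightarrow> z \<in> elts Sm \<and>
        (x = z \<or> (\<forall>x'\<in>elts A. x' \<notin> elts Sm) \<and> rel2 mulR z x oneR)" if "x \<in> elts A" for z
    proof (cases "z \<in> elts R")
      case True
      then have "rel2 mulR z x oneR \<longleftrightarrow> z \<otimes>\<^sub>R x = oneR" using rel2_mul[of z x oneR] that AR by auto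
      then show ?thesis unfolding code_def Sm using AR by blast
    qed (simp add: code_def Sm)
    show ?thesis
    proof
      assume E: "E A x y"
      then obtain n r z u where *: "x \<in> elts A" "rel h A n \<and> rel W n r" "z \<in> elts Sm"
        "x = z \<or> (\<forall>x'\<in>elts A. x' \<notin> elts Sm) \<and> rel2 mulR z x oneR"
        "rel2 addR z two u \<and> rel2 addR r u y" unfolding E_def by blast
      have "code A x z" unfolding 3[OF *(1)] using *(3,4) ..
      moreover have "r = lo A" "z \<in> elts R" using *(2,3) 1[of n r] Sm by simp_all
      then have "y = lo A \<oplus>\<^sub>R (z \<oplus>\<^sub>R two)" using *(5) 2[of z u] by simp
      ultimately show "x \<in> elts A \<and> (\<exists>z. code A x z \<and> y = lo A \<oplus>\<^sub>R (z \<oplus>\<^sub>R two))" using *(1) by blast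
    next
      assume "x \<in> elts A \<and> (\<exists>z. code A x z \<and> y = lo A \<oplus>\<^sub>R (z \<oplus>\<^sub>R two))"
      then obtain z where z: "x \<in> elts A" "code A x z" "y = lo A \<oplus>\<^sub>R (z \<oplus>\<^sub>R two)" by blast
      then have "rel2 addR z two (z \<oplus>\<^sub>R two) \<and> rel2 addR (lo A) (z \<oplus>\<^sub>R two) y"
        using 2[of z "z \<oplus>\<^sub>R two"] unfolding code_def by blast
      moreover have "rel h A (app h A) \<and> rel W (app h A) (lo A)" using 1 by simp
      moreover have "z \<in> elts Sm \<and> (x = z \<or> (\<forall>x'\<in>elts A. x' \<notin> elts Sm) \<and> rel2 mulR z x oneR)"
        using z(2) unfolding 3[OF z(1)] .
      ultimately show "E A x y" unfolding E_def using z(1) by blast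
    qed
  qed
  have inverse_unique: "a = b"
    if "a \<in> elts R" "b \<in> elts R" "z \<in> elts R" "z \<otimes>\<^sub>R a = oneR" "z \<otimes>\<^sub>R b = oneR" for a b z
    using K.inv_unique[of a z b] K.m_comm[of a z] that by simp
  show "\<exists>c. choice_function c F"
  proof (rule ex_choice_from_separated_codes[of E F lo hi, OF Loeb])
    show "definable (\<lambda>v. E (v 0) (v 1) (v 2))"
      unfolding E_def by (intro definable_intros)
    fix A assume A: "A \<in> elts F"
    then have AR: "elts A \<subseteq> elts R" using F by blast
    show "lo A \<in> elts R \<and> hi A \<in> elts R" using loR hiR A by blast
    show "is_countable A" using F A by blast
    show range: "x \<in> elts A \<and> y \<in> elts R \<and> lo A \<prec> y \<and> y \<prec> hi A" if xy: "E A x y" for x y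
    proof -
      obtain z where z: "x \<in> elts A" "code A x z" "y = lo A \<oplus>\<^sub>R (z \<oplus>\<^sub>R two)"
        using xy E_iff[OF A] by blast
      then have zs: "z \<in> elts R" "zeroR \<prec> z \<oplus>\<^sub>R two" "z \<oplus>\<^sub>R two \<prec> width"
        unfolding code_def small_def by blast+
      have "lo A \<prec> y" using add_left_mono[of zeroR "z \<oplus>\<^sub>R two" "lo A"] zs z(3) loR[OF A] by simp
      moreover have "y \<prec> hi A"
        using add_left_mono[of "z \<oplus>\<^sub>R two" width "lo A"] zs z(3) loR[OF A] hi_def by simp
      ultimately show ?thesis using z zs loR[OF A] by simp
    qed
    show "x = x'" if xy: "E A x y" "E A x' y" for x x' y
    proof -
      obtain z where z: "x \<in> elts A" "code A x z" "y = lo A \<oplus>\<^sub>R (z \<oplus>\<^sub>R two)"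
        using xy(1) E_iff[OF A] by blast
      obtain z' where z': "x' \<in> elts A" "code A x' z'" "y = lo A \<oplus>\<^sub>R (z' \<oplus>\<^sub>R two)"
        using xy(2) E_iff[OF A] by blast
      have zR: "z \<in> elts R" "z' \<in> elts R" using z z' unfolding code_def by blast+
      have "z \<oplus>\<^sub>R two = z' \<oplus>\<^sub>R two"
        using add_left_cancel[of "z \<oplus>\<^sub>R two" "z' \<oplus>\<^sub>R two" "lo A"] z(3) z'(3) zR loR[OF A] by simp
      then have "z = z'"
        using add_left_cancel[of z z' two] K.a_comm[of z two] K.a_comm[of z' two] zR by simp
      then show ?thesis
        using z(1,2) z'(1,2) inverse_unique[of x x' z] AR unfolding code_def by blast
    qed
    show "y = y'" if xy: "E A x y" "E A x y'" for x y y'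
    proof -
      obtain z where z: "x \<in> elts A" "code A x z" "y = lo A \<oplus>\<^sub>R (z \<oplus>\<^sub>R two)"
        using xy(1) E_iff[OF A] by blast
      obtain z' where z': "code A x z'" "y' = lo A \<oplus>\<^sub>R (z' \<oplus>\<^sub>R two)"
        using xy(2) E_iff[OF A] by blast
      have "z = z'"
        using z(1,2) z'(1) inverse_unique[of z z' x] AR K.m_comm[of x z] K.m_comm[of x z']
        unfolding code_def by auto
      then show ?thesis using z z' by simp
    qed
    show "\<exists>x y. E A x y"
    proof (cases "\<exists>x\<in>elts A. small x")
      case True
      then obtain x where "x \<in> elts A" "code A x x" unfolding code_def using AR by blast
      then show ?thesis using E_iff[OF A] by blast
    next
      case False
      obtain x where x: "x \<in> elts A" using F A by blast
      then obtain z where "z \<in> elts R" "small z" "z \<otimes>\<^sub>R x = oneR"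
        using small_or_small_inverse[of x] False AR by blast
      then have "code A x z" unfolding code_def using False by blast
      then show ?thesis using E_iff[OF A] x by blast
    qed
    show "A' = A" if A': "A' \<in> elts F" and y: "E A' x y" "lo A \<prec> y" "y \<prec> hi A" for A' x y
    proof (rule ccontr)
      assume "A' \<noteq> A"
      then have "app h A' \<noteq> app h A" using inj_onD[OF h_inj] A A' by blast
      then consider "app h A \<in> elts (app h A')" | "app h A' \<in> elts (app h A)"
        using omega_linear[OF hA[OF A] hA[OF A']] by auto
      moreover obtain z where "code A' x z" "y = lo A' \<oplus>\<^sub>R (z \<oplus>\<^sub>R two)"
        using y(1) E_iff[OF A'] by blast
      then have zs: "z \<in> elts R" "zeroR \<prec> z \<oplus>\<^sub>R two" "z \<oplus>\<^sub>R two \<prec> width"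
        and yR: "y \<in> elts R" and y_eq: "y = lo A' \<oplus>\<^sub>R (z \<oplus>\<^sub>R two)"
        using loR[OF A'] unfolding code_def small_def by auto
      have "lo A' \<prec> y" using add_left_mono[of zeroR "z \<oplus>\<^sub>R two" "lo A'"] zs y_eq loR[OF A'] by simp
      moreover have "y \<prec> hi A'"
        using add_left_mono[of "z \<oplus>\<^sub>R two" width "lo A'"] zs y_eq loR[OF A'] hi_def by simp
      ultimately have disjoint: "(lo A' \<prec> y \<and> y \<prec> hi A') \<and> (hi A \<prec> lo A' \<or> hi A = lo A' \<or> hi A' \<prec> lo A \<or> hi A' = lo A)"
        using spaced[OF hA[OF A]] spaced[OF hA[OF A']] unfolding hi_def lo_def by metis
      note trans = less_trans[OF yR hiR[OF A] yR] less_trans[OF yR hiR[OF A'] yR]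
        less_trans[OF hiR[OF A] loR[OF A'] yR] less_trans[OF hiR[OF A'] loR[OF A] yR]
      show False using disjoint trans y(2,3) less_irrefl[OF yR] by auto
    qed
  qed
qed

end

theorem theorem2p10:
  fixes mem :: "'a \<Rightarrow> 'a \<Rightarrow> bool"
    and R addR mulR zeroR oneR ltR :: 'a
  assumes "zf_model mem"
    and "set_structure.real_field mem R addR mulR zeroR oneR ltR"
  shows
    "((\<forall>T X S. set_structure.usual_topology mem R ltR T \<and>
               set_structure.is_subspace mem X S R T \<and>
               set_structure.sequential mem X S \<longrightarrow> set_structure.Loeb mem X S)
        \<longrightarrow> set_structure.CAC_omega mem R)
     \<and>
     ((\<forall>X T. set_structure.metrizable mem R addR zeroR ltR X T \<and>
             set_structure.sequential mem X T \<longrightarrow> set_structure.Loeb mem X T)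
        \<longleftrightarrow> set_structure.AC mem)"
proof -
  interpret zf_model mem by fact
  interpret model_reals mem R addR mulR zeroR oneR ltR by unfold_locales fact
  show ?thesis
  proof (intro conjI impI iffI allI)
    assume "\<forall>T X S. usual_topology R ltR T \<and> is_subspace X S R T \<and> sequential X S \<longrightarrow> Loeb X S"
    then show "CAC_omega R" by (intro Loeb_imp_CAC_omega) blast
  next
    assume "\<forall>X T. metrizable R addR zeroR ltR X T \<and> sequential X T \<longrightarrow> Loeb X T"
    then show AC by (intro Loeb_imp_AC) blast
  next
    fix X T
    assume AC and "metrizable R addR zeroR ltR X T \<and> sequential X T"
    then show "Loeb X T" by (intro AC_imp_Loeb) (auto simp: sequential_def)
  qed
qed

end
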